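(* Let $dx^2$ be the Euclidean metric on $\mathbb{R}^n$. Suppose that $(\phi,\tau)\in C^\infty(\mathbb{R}^n)\times\mathbb{R}_+$ belongs to $\mathcal{C}_1(dx^2)$ and is a critical point of the functional $\mathcal{W}_2\colon\mathcal{C}_1(dx^2)\to\mathbb{R}$. Suppose additionally that, with $\lambda=\frac{1}{2\tau}$, $$\widetilde{\sigma}_{1,\phi}<\frac{1}{2\tau},\qquad \widetilde{\sigma}_{2,\phi}>\frac{1}{2\tau}\widetilde{\sigma}_{1,\phi}-\frac{1}{8\tau^2}$$ everywhere on $\mathbb{R}^n$, and that the function $\widetilde{\phi}(x)=|x|^2\phi\left(x/|x|^2\right)$ extends to a $C^2$ function on $\mathbb{R}^n$ such that $\widetilde{\phi}(0)>0$. Then there is a point $x_0\in\mathbb{R}^n$ such that $$\phi(x)=\frac{|x-x_0|^2}{4\tau}\qquad\text{for all }x\in\mathbb{R}^n .$$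
   Context: For $\phi\in C^\infty(\mathbb{R}^n)$ and $\lambda\in\mathbb{R}$ (flat metric, so $R=0$, $\operatorname{Ric}=0$): $$\widetilde{\sigma}_{1,\phi}:=\tfrac12\left(2\Delta\phi-|\nabla\phi|^2\right)+\lambda(\phi-n),\qquad \widetilde{\sigma}_{2,\phi}:=\tfrac12\left((\widetilde{\sigma}_{1,\phi})^2-|\nabla^2\phi-\lambda\,dx^2|^2\right).$$ $\mathcal{C}_1(dx^2):=\{(\phi,\tau)\in C^\infty(\mathbb{R}^n)\times\mathbb{R}_+:\int_{\mathbb{R}^n}(4\pi\tau)^{-n/2}e^{-\phi}\,\mathrm{dvol}=1\}$, and $$\mathcal{W}_2(dx^2,\phi,\tau):=\int_{\mathbb{R}^n}\tau^2\,\widetilde{\sigma}_{2,\phi}\,(4\pi\tau)^{-n/2}e^{-\phi}\,\mathrm{dvol}\quad\text{with }\lambda=\tfrac1{2\tau}.$$ $(\phi,\tau)$ is a critical point of $\mathcal{W}_2\colon\mathcal{C}_1(dx^2)\to\mathbb{R}$ if $\frac{d}{dt}\big|_{t=0}\mathcal{W}_2(dx^2,\phi_t,\tau_t)=0$ for every smooth curve $(\phi_t,\tau_t)$ in $\mathcal{C}_1(dx^2)$ with $(\phi_0,\tau_0)=(\phi,\tau)$ and with $\phi_t-\phi$ supported in a compact set independent of $t$. *)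

theory Defs
  imports "HOL-Analysis.Analysis"
begin

definition partial_deriv :: "'a::euclidean_space \<Rightarrow> ('a \<Rightarrow> real) \<Rightarrow> 'a \<Rightarrow> real" where
  "partial_deriv b f x = frechet_derivative f (at x) b"

text \<open>Intended for open \<open>S\<close> only: derivatives are taken with respect to full neighbourhoods
  of the points of \<open>S\<close>.\<close>

primrec C_k_on :: "nat \<Rightarrow> 'a::euclidean_space set \<Rightarrow> ('a \<Rightarrow> real) \<Rightarrow> bool" where
  "C_k_on 0 S f \<longleftrightarrow> continuous_on S f"
| "C_k_on (Suc k) S f \<longleftrightarrow>
     (\<forall>x\<in>S. f differentiable (at x)) \<and> (\<forall>b\<in>Basis. C_k_on k S (partial_deriv b f))"

definition smooth_on :: "'a::euclidean_space set \<Rightarrow> ('a \<Rightarrow> real) \<Rightarrow> bool" where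
  "smooth_on S f \<longleftrightarrow> (\<forall>k. C_k_on k S f)"

definition gradient :: "(real ^ 'n \<Rightarrow> real) \<Rightarrow> real ^ 'n \<Rightarrow> real ^ 'n" where
  "gradient f x = (\<chi> i. partial_deriv (axis i 1) f x)"

definition hessian :: "(real ^ 'n \<Rightarrow> real) \<Rightarrow> real ^ 'n \<Rightarrow> real ^ 'n ^ 'n" where
  "hessian f x = (\<chi> i j. partial_deriv (axis i 1) (partial_deriv (axis j 1) f) x)"

definition laplacian :: "(real ^ 'n \<Rightarrow> real) \<Rightarrow> real ^ 'n \<Rightarrow> real" where
  "laplacian f x = trace (hessian f x)"

definition sigma1 :: "real \<Rightarrow> (real ^ 'n \<Rightarrow> real) \<Rightarrow> real ^ 'n \<Rightarrow> real" where
  "sigma1 lam \<phi> x =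
     (1/2) * (2 * laplacian \<phi> x - (norm (gradient \<phi> x))\<^sup>2) + lam * (\<phi> x - real CARD('n))"

text \<open>The norm on \<open>real ^ 'n ^ 'n\<close> is the Frobenius norm, i.e. the norm that the Euclidean metric
  induces on 2-tensors; \<open>mat lam\<close> is \<open>lam\<close> times the identity matrix.\<close>

definition sigma2 :: "real \<Rightarrow> (real ^ 'n \<Rightarrow> real) \<Rightarrow> real ^ 'n \<Rightarrow> real" where
  "sigma2 lam \<phi> x = (1/2) * ((sigma1 lam \<phi> x)\<^sup>2 - (norm (hessian \<phi> x - mat lam))\<^sup>2)"

definition weight :: "(real ^ 'n \<Rightarrow> real) \<Rightarrow> real \<Rightarrow> real ^ 'n \<Rightarrow> real" where
  "weight \<phi> \<tau> x = (4 * pi * \<tau>) powr (- (real CARD('n) / 2)) * exp (- \<phi> x)"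

text \<open>The Bochner integral of a non-integrable function is 0, so the normalisation
  also forces the weight to be integrable.\<close>

definition C1_space :: "((real ^ 'n \<Rightarrow> real) \<times> real) set" where
  "C1_space = {(\<phi>, \<tau>). smooth_on UNIV \<phi> \<and> \<tau> > 0 \<and> (LINT x|lborel. weight \<phi> \<tau> x) = 1}"

definition W2 :: "(real ^ 'n \<Rightarrow> real) \<Rightarrow> real \<Rightarrow> real" where
  "W2 \<phi> \<tau> = (LINT x|lborel. \<tau>\<^sup>2 * sigma2 (1 / (2 * \<tau>)) \<phi> x * weight \<phi> \<tau> x)"

text \<open>A smooth curve \<open>t \<mapsto> (\<Phi> t, T t)\<close> in \<open>C1_space\<close> through \<open>(\<phi>, \<tau>)\<close> at time 0, defined for
  \<open>\<bar>t\<bar> < \<epsilon>\<close>, whose first component varies only inside a fixed compact set. Smoothness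
  of the first component means joint smoothness in time and space.\<close>

definition admissible_curve ::
  "(real ^ 'n \<Rightarrow> real) \<Rightarrow> real \<Rightarrow> real \<Rightarrow> (real \<Rightarrow> real ^ 'n \<Rightarrow> real) \<Rightarrow> (real \<Rightarrow> real) \<Rightarrow> bool" where
  "admissible_curve \<phi> \<tau> \<epsilon> \<Phi> T \<longleftrightarrow>
     \<epsilon> > 0 \<and>
     smooth_on ({-\<epsilon><..<\<epsilon>} \<times> UNIV) (\<lambda>(t, x). \<Phi> t x) \<and>
     smooth_on {-\<epsilon><..<\<epsilon>} T \<and>
     (\<forall>t\<in>{-\<epsilon><..<\<epsilon>}. (\<Phi> t, T t) \<in> C1_space) \<and>
     \<Phi> 0 = \<phi> \<and> T 0 = \<tau> \<and>
     (\<exists>K. compact K \<and> (\<forall>t\<in>{-\<epsilon><..<\<epsilon>}. \<forall>x. x \<notin> K \<longrightarrow> \<Phi> t x - \<phi> x = 0))"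

definition W2_critical :: "(real ^ 'n \<Rightarrow> real) \<Rightarrow> real \<Rightarrow> bool" where
  "W2_critical \<phi> \<tau> \<longleftrightarrow>
     (\<forall>\<epsilon> \<Phi> T. admissible_curve \<phi> \<tau> \<epsilon> \<Phi> T \<longrightarrow>
        ((\<lambda>t. W2 (\<Phi> t) (T t)) has_real_derivative 0) (at 0))"

end

theory Submission
  imports Defs "HOL-Probability.Distributions"
begin

text \<open>
  This is an Obata-type argument. Write \<open>lam = 1 / (2 \<tau>)\<close>, \<open>A = \<nabla>\<^sup>2\<phi> - lam I\<close> and
  \<open>s = \<sigma>\<^sub>1 - lam\<close>. Variations of \<open>\<phi>\<close> with \<open>\<tau>\<close> fixed show that \<open>\<sigma>\<^sub>2 - lam \<sigma>\<^sub>1\<close> is constant, i.e. that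
  \<open>s\<^sup>2 - |A|\<^sup>2\<close> is constant; the two pointwise inequalities say that \<open>s < 0\<close> and \<open>|A| < - s\<close>.
  The weighted divergence of \<open>T A\<close>, where \<open>T = s I - A\<close>, is half the gradient of
  \<open>s\<^sup>2 - |A|\<^sup>2\<close>, so it vanishes. Pairing with the gradient of \<open>z = \<phi> - lam |x|\<^sup>2 / 2\<close>, whose
  Hessian is \<open>A\<close>, gives \<open>\<integral> \<langle>T A, A\<rangle> exp (- \<phi>) = 0\<close>. Since
  \<open>\<langle>T A, A\<rangle> \<le> |A|\<^sup>2 (s + |A|) \<le> 0\<close>, this forces \<open>A = 0\<close>, so \<open>\<phi>\<close> is quadratic, and the
  normalisation fixes its additive constant. The extension of \<open>|x|\<^sup>2 \<phi> (x / |x|\<^sup>2)\<close> to the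
  origin only serves to give Gaussian decay of \<open>exp (- \<phi>)\<close> and polynomial growth of the
  derivatives of \<open>\<phi>\<close>, which justifies the integrations by parts.
\<close>

section \<open>Calculus of smooth functions\<close>

text \<open>Two identities drive the argument. The weighted divergence of \<open>A\<close> is the
  gradient of \<open>sigma1\<close>, because the undifferentiated term \<open>lam * \<phi>\<close>
  of \<open>sigma1\<close> accounts for the summand - lam I of \<open>A\<close>. Hence in the
  weighted divergence of s A - A A the terms with \<open>A\<close> applied to the gradient of s
  cancel, and symmetry of third derivatives turns the rest into half the gradient of s^2 - |A|^2.
  This holds for every constant shift of \<open>sigma1\<close>. The shift by lam is forced by the
  Euler-Lagrange equation, where the same undifferentiated \<open>\<phi>\<close> produces the term
  lam sigma1; completing the square leaves lam^2 / 2, which is the 1 / (8 tau^2) of the hypothesis.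
  The pairing uses the gradient of z because its Hessian is exactly \<open>A\<close>, so that a form
  in \<open>A\<close> alone appears. A non-integrable function has Bochner integral 0, so
  criticality becomes usable only once \<open>sigma2\<close> times the weight is known to be
  integrable. The growth estimates therefore serve the first variation already, not only the final
  integration by parts.\<close>

lemma partial_deriv_eqI:
  "(f has_derivative f') (at x) \<Longrightarrow> partial_deriv b f x = f' b"
  unfolding partial_deriv_def by (metis frechet_derivative_at)

lemma has_derivative_frechet:
  "f differentiable at x \<Longrightarrow> (f has_derivative frechet_derivative f (at x)) (at x)"
  by (simp add: frechet_derivative_works)

lemma partial_deriv_const [simp]: "partial_deriv b (\<lambda>x. c) x = 0"
  by (rule partial_deriv_eqI) (rule has_derivative_const)

lemma partial_deriv_bounded_linear: "bounded_linear f \<Longrightarrow> partial_deriv b f x = f b"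
  by (rule partial_deriv_eqI) (rule bounded_linear_imp_has_derivative)

lemma partial_deriv_add:
  assumes "f differentiable at x" "g differentiable at x"
  shows "partial_deriv b (\<lambda>x. f x + g x) x = partial_deriv b f x + partial_deriv b g x"
  using has_derivative_add[OF assms[THEN has_derivative_frechet]]
  by (auto dest!: partial_deriv_eqI simp: partial_deriv_def)

lemma partial_deriv_diff:
  assumes "f differentiable at x" "g differentiable at x"
  shows "partial_deriv b (\<lambda>x. f x - g x) x = partial_deriv b f x - partial_deriv b g x"
  using has_derivative_diff[OF assms[THEN has_derivative_frechet]]
  by (auto dest!: partial_deriv_eqI simp: partial_deriv_def)

lemma partial_deriv_mult:
  assumes "f differentiable at x" "g differentiable at x"
  shows "partial_deriv b (\<lambda>x. f x * g x) x = f x * partial_deriv b g x + partial_deriv b f x * g x"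
  using has_derivative_mult[OF assms[THEN has_derivative_frechet]]
  by (auto dest!: partial_deriv_eqI simp: partial_deriv_def)

lemma partial_deriv_sum:
  assumes "\<And>i. i \<in> I \<Longrightarrow> f i differentiable at x"
  shows "partial_deriv b (\<lambda>x. \<Sum>i\<in>I. f i x) x = (\<Sum>i\<in>I. partial_deriv b (f i) x)"
proof -
  have "((\<lambda>x. \<Sum>i\<in>I. f i x) has_derivative (\<lambda>v. \<Sum>i\<in>I. frechet_derivative (f i) (at x) v)) (at x)"
    by (intro has_derivative_sum has_derivative_frechet assms)
  from partial_deriv_eqI[OF this] show ?thesis by (simp add: partial_deriv_def)
qed

lemma has_derivative_real_compose:
  assumes "f differentiable at x" "(g has_real_derivative d) (at (f x))"
  shows "((\<lambda>x. g (f x)) has_derivative (\<lambda>v. d * frechet_derivative f (at x) v)) (at x)"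
  using has_derivative_compose[OF has_derivative_frechet[OF assms(1)]
      assms(2)[unfolded has_field_derivative_def]] by (simp add: o_def)

lemma partial_deriv_real_compose:
  assumes "f differentiable at x" "(g has_real_derivative d) (at (f x))"
  shows "partial_deriv b (\<lambda>x. g (f x)) x = d * partial_deriv b f x"
  using has_derivative_real_compose[OF assms] partial_deriv_eqI partial_deriv_def by metis

lemma partial_deriv_cong_open:
  assumes "open S" "x \<in> S" "\<And>y. y \<in> S \<Longrightarrow> f y = g y" "f differentiable at x"
  shows "g differentiable at x" "partial_deriv b g x = partial_deriv b f x"
proof -
  have "(g has_derivative frechet_derivative f (at x)) (at x)"
    using has_derivative_transform_within_open[OF has_derivative_frechet[OF assms(4)] assms(1,2,3)] .
  then show "g differentiable at x" "partial_deriv b g x = partial_deriv b f x"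
    by (auto simp: differentiable_def partial_deriv_def dest: frechet_derivative_at[symmetric])
qed

section \<open>Closure properties of finite differentiability classes\<close>

lemma C_k_on_continuous_on: "C_k_on k S f \<Longrightarrow> continuous_on S f"
  by (cases k)
    (auto intro!: continuous_at_imp_continuous_on differentiable_imp_continuous_within)

lemma C_k_on_SucD: "C_k_on (Suc k) S f \<Longrightarrow> C_k_on k S f"
proof (induction k arbitrary: f)
  case 0
  then show ?case using C_k_on_continuous_on by (metis C_k_on.simps(1))
next
  case (Suc k)
  from Suc.prems have "\<forall>x\<in>S. f differentiable at x"
    and "\<forall>b\<in>Basis. C_k_on (Suc k) S (partial_deriv b f)"
    using iffD1[OF C_k_on.simps(2) Suc.prems] by blast+
  with Suc.IH show ?case by (simp only: C_k_on.simps(2)) blast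
qed

lemma C_k_on_subset: "C_k_on k S f \<Longrightarrow> T \<subseteq> S \<Longrightarrow> C_k_on k T f"
  by (induction k arbitrary: f) (auto intro: continuous_on_subset)

text \<open>Equality on an open set passes to all derivatives there. This makes the sum, product and
  chain rules usable inside \<open>C_k_on\<close>, although they hold only where the functions
  involved are differentiable.\<close>

lemma C_k_on_cong:
  assumes "open S"
  shows "(\<And>x. x \<in> S \<Longrightarrow> f x = g x) \<Longrightarrow> C_k_on k S f \<Longrightarrow> C_k_on k S g"
proof (induction k arbitrary: f g)
  case 0
  then show ?case using continuous_on_cong by (metis C_k_on.simps(1))
next
  case (Suc k)
  have d: "g differentiable at x" "partial_deriv b f x = partial_deriv b g x" if "x \<in> S" for x b
    using partial_deriv_cong_open[OF assms that Suc.prems(1)] Suc.prems(2) that by auto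
  have "C_k_on k S (partial_deriv b g)" if "b \<in> Basis" for b
    by (rule Suc.IH[of "partial_deriv b f"]) (use d Suc.prems that in auto)
  then show ?case using d by auto
qed

lemma C_k_on_const [simp, intro]: "C_k_on k S (\<lambda>x. c)"
proof (induction k arbitrary: c)
  case (Suc k)
  have "partial_deriv b (\<lambda>x. c) = (\<lambda>x. 0)" for b :: 'a by (rule ext) simp
  then show ?case using Suc by simp
qed simp

lemma C_k_on_bounded_linear: "bounded_linear f \<Longrightarrow> C_k_on k S f"
proof (cases k)
  case (Suc k)
  assume f: "bounded_linear f"
  have "partial_deriv b f = (\<lambda>x. f b)" for b
    using partial_deriv_bounded_linear[OF f] by (rule ext)
  then show ?thesis using Suc f bounded_linear_imp_differentiable by auto
qed (auto intro: linear_continuous_on)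

lemma C_k_on_add:
  assumes "open S"
  shows "C_k_on k S f \<Longrightarrow> C_k_on k S g \<Longrightarrow> C_k_on k S (\<lambda>x. f x + g x)"
proof (induction k arbitrary: f g)
  case (Suc k)
  have "C_k_on k S (partial_deriv b (\<lambda>x. f x + g x))" if "b \<in> Basis" for b
    by (rule C_k_on_cong[OF assms, of "\<lambda>x. partial_deriv b f x + partial_deriv b g x"])
      (use Suc that in \<open>auto simp: partial_deriv_add\<close>)
  then show ?case using Suc.prems by auto
qed (auto intro: continuous_on_add)

lemma C_k_on_mult:
  assumes "open S"
  shows "C_k_on k S f \<Longrightarrow> C_k_on k S g \<Longrightarrow> C_k_on k S (\<lambda>x. f x * g x)"
proof (induction k arbitrary: f g)
  case (Suc k)
  note fg = Suc.prems[THEN C_k_on_SucD]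
  have "C_k_on k S (partial_deriv b (\<lambda>x. f x * g x))" if "b \<in> Basis" for b
    by (rule C_k_on_cong[OF assms, of "\<lambda>x. f x * partial_deriv b g x + partial_deriv b f x * g x"])
      (use Suc that fg in \<open>auto simp: partial_deriv_mult intro!: C_k_on_add[OF assms]\<close>)
  then show ?case using Suc.prems by auto
qed (auto intro: continuous_on_mult)

lemma C_k_on_sum:
  assumes "open S" "\<And>i. i \<in> I \<Longrightarrow> C_k_on k S (f i)"
  shows "C_k_on k S (\<lambda>x. \<Sum>i\<in>I. f i x)"
  using assms(2) by (induction I rule: infinite_finite_induct) (auto intro: C_k_on_add[OF assms(1)])

text \<open>\<open>G i\<close> plays the role of the i-th derivative of one outer function. The
  induction must leave i free, because each differentiation moves from \<open>G i\<close> to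
  \<open>G (Suc i)\<close>.\<close>

lemma C_k_on_compose:
  assumes "open S"
    and G: "\<And>i x. x \<in> S \<Longrightarrow> (G i has_real_derivative G (Suc i) (f x)) (at (f x))"
    and f: "C_k_on k S f"
  shows "C_k_on k S (\<lambda>x. G i (f x))"
  using f
proof (induction k arbitrary: i)
  case 0
  have "continuous_on (f ` S) (G i)"
    using G DERIV_isCont by (blast intro!: continuous_at_imp_continuous_on)
  then show ?case using continuous_on_compose2[of "f ` S" "G i" S f] 0 by auto
next
  case (Suc k)
  have fd: "f differentiable at x" if "x \<in> S" for x using Suc.prems that by simp
  have "C_k_on k S (partial_deriv b (\<lambda>x. G i (f x)))" if "b \<in> Basis" for b
    by (rule C_k_on_cong[OF assms(1), of "\<lambda>x. G (Suc i) (f x) * partial_deriv b f x"])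
      (use Suc.prems that partial_deriv_real_compose[OF fd G] in
        \<open>simp_all add: C_k_on_mult[OF assms(1)] Suc.IH[OF C_k_on_SucD]\<close>)
  moreover have "(\<lambda>x. G i (f x)) differentiable at x" if "x \<in> S" for x
    using has_derivative_real_compose[OF fd G, OF that that] differentiable_def by blast
  ultimately show ?case by auto
qed

text \<open>A basis vector of the product lies in one of the two factors: in the first it kills the
  function, in the second it acts as a partial derivative of \<open>f\<close>. Needed for joint
  smoothness in time and space of a curve of functions.\<close>

lemma C_k_on_snd:
  fixes f :: "'b::euclidean_space \<Rightarrow> real"
  assumes "C_k_on k UNIV f"
  shows "C_k_on k UNIV (\<lambda>p::'a::euclidean_space \<times> 'b. f (snd p))"
  using assms
proof (induction k arbitrary: f)
  case 0
  then show ?case by (auto intro!: continuous_on_compose2[of UNIV f] continuous_intros)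
next
  case (Suc k)
  have d: "((\<lambda>p::'a \<times> 'b. f (snd p)) has_derivative
      (\<lambda>v. frechet_derivative f (at (snd p)) (snd v))) (at p)" for p
    by (rule has_derivative_compose[OF _ has_derivative_frechet])
      (use Suc.prems in \<open>auto intro!: derivative_eq_intros\<close>)
  have "C_k_on k UNIV (partial_deriv b (\<lambda>p::'a \<times> 'b. f (snd p)))" if "b \<in> Basis" for b
  proof (cases "snd b = 0")
    case True
    have "partial_deriv b (\<lambda>p::'a \<times> 'b. f (snd p)) = (\<lambda>p. 0)"
      using partial_deriv_eqI[OF d] Suc.prems True
      by (intro ext) (simp add: linear_0 linear_frechet_derivative)
    then show ?thesis by simp
  next
    case False
    then have "snd b \<in> Basis" using that by (auto simp: Basis_prod_def)
    moreover have "partial_deriv b (\<lambda>p::'a \<times> 'b. f (snd p)) = (\<lambda>p. partial_deriv (snd b) f (snd p))"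
      using partial_deriv_eqI[OF d] by (intro ext) (simp add: partial_deriv_def[of "snd b"])
    ultimately show ?thesis using Suc by simp
  qed
  then show ?case using differentiableI[OF d] by simp
qed

section \<open>Closure properties of smooth functions\<close>

lemma smooth_onD:
  assumes "smooth_on S f"
  shows "x \<in> S \<Longrightarrow> f differentiable at x"
    and "continuous_on S f"
    and "b \<in> Basis \<Longrightarrow> smooth_on S (partial_deriv b f)"
proof -
  have *: "C_k_on (Suc k) S f" for k using assms by (simp only: smooth_on_def)
  show "x \<in> S \<Longrightarrow> f differentiable at x" using *[of 0] by simp
  show "continuous_on S f" using *[of 0] by (rule C_k_on_continuous_on)
  show "b \<in> Basis \<Longrightarrow> smooth_on S (partial_deriv b f)" using * by (simp add: smooth_on_def)
qed

lemma smooth_on_const [simp, intro]: "smooth_on S (\<lambda>x. c)"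
  and smooth_on_bounded_linear: "bounded_linear f \<Longrightarrow> smooth_on S f"
  by (simp_all add: smooth_on_def C_k_on_bounded_linear)

lemma
  assumes "open S"
  shows smooth_on_add: "smooth_on S f \<Longrightarrow> smooth_on S g \<Longrightarrow> smooth_on S (\<lambda>x. f x + g x)"
    and smooth_on_mult: "smooth_on S f \<Longrightarrow> smooth_on S g \<Longrightarrow> smooth_on S (\<lambda>x. f x * g x)"
    and smooth_on_compose:
      "(\<And>i x. x \<in> S \<Longrightarrow> (G i has_real_derivative G (Suc i) (f x)) (at (f x))) \<Longrightarrow>
        smooth_on S f \<Longrightarrow> smooth_on S (\<lambda>x. G i (f x))"
  using C_k_on_add[OF assms] C_k_on_mult[OF assms] C_k_on_compose[OF assms, of G f]
  unfolding smooth_on_def by blast+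

lemma smooth_on_diff:
  assumes "open S" "smooth_on S f" "smooth_on S g"
  shows "smooth_on S (\<lambda>x. f x - g x)"
  using smooth_on_add[OF assms(1,2) smooth_on_mult[OF assms(1) smooth_on_const[of _ "-1"] assms(3)]]
  by simp

lemma smooth_on_sum:
  assumes "open S" "\<And>i. i \<in> I \<Longrightarrow> smooth_on S (f i)"
  shows "smooth_on S (\<lambda>x. \<Sum>i\<in>I. f i x)"
  using assms(2) by (induction I rule: infinite_finite_induct) (auto intro: smooth_on_add[OF assms(1)])

lemma smooth_on_norm_power2:
  fixes p :: "'a::euclidean_space"
  shows "smooth_on UNIV (\<lambda>x. (norm (x - p))\<^sup>2)"
proof -
  have "smooth_on UNIV (\<lambda>x::'a. \<Sum>b\<in>Basis. (x \<bullet> b - p \<bullet> b) * (x \<bullet> b - p \<bullet> b))"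
    by (intro smooth_on_sum smooth_on_mult smooth_on_diff smooth_on_const smooth_on_bounded_linear
        bounded_linear_inner_left open_UNIV)
  also have "(\<lambda>x. \<Sum>b\<in>Basis. (x \<bullet> b - p \<bullet> b) * (x \<bullet> b - p \<bullet> b)) = (\<lambda>x. (norm (x - p))\<^sup>2)"
  proof
    fix x
    show "(\<Sum>b\<in>Basis. (x \<bullet> b - p \<bullet> b) * (x \<bullet> b - p \<bullet> b)) = (norm (x - p))\<^sup>2"
      unfolding power2_norm_eq_inner
      by (subst euclidean_inner) (simp only: inner_diff_left)
  qed
  finally show ?thesis .
qed

text \<open>Schwarz's theorem: the second difference of \<open>f\<close> over a square of side h
  does not depend on the order of the directions. Two applications of the mean value theorem express
  it by either mixed derivative at a nearby point, and continuity lets h shrink.\<close>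

lemma partial_deriv_commute:
  fixes f :: "'a::euclidean_space \<Rightarrow> real"
  assumes f: "C_k_on 2 UNIV f" and a: "a \<in> Basis" and b: "b \<in> Basis"
  shows "partial_deriv a (partial_deriv b f) x = partial_deriv b (partial_deriv a f) x"
proof -
  have f': "f differentiable at y" for y
    using f by (auto simp: numeral_2_eq_2)
  have f'': "partial_deriv c f differentiable at y" if "c \<in> Basis" for c y
    using f that by (auto simp: numeral_2_eq_2)
  have cont: "continuous_on UNIV (partial_deriv c (partial_deriv d f))"
    if "c \<in> Basis" "d \<in> Basis" for c d
    using f that by (auto simp: numeral_2_eq_2)
  have dir: "((\<lambda>s. g (z + s *\<^sub>R c)) has_real_derivative partial_deriv c g (z + s *\<^sub>R c)) (at s)"
    if "\<And>y. g differentiable at y" for g :: "'a \<Rightarrow> real" and z c s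
  proof -
    have "((\<lambda>s. g (z + s *\<^sub>R c)) has_derivative
        (\<lambda>h. frechet_derivative g (at (z + s *\<^sub>R c)) (h *\<^sub>R c))) (at s)"
      by (rule has_derivative_compose[OF _ has_derivative_frechet[OF that]])
        (auto intro!: derivative_eq_intros)
    moreover have "frechet_derivative g (at (z + s *\<^sub>R c)) (h *\<^sub>R c)
        = partial_deriv c g (z + s *\<^sub>R c) * h" for h
      by (simp add: partial_deriv_def linear_scale[OF linear_frechet_derivative[OF that]])
    ultimately show ?thesis by (simp add: has_field_derivative_def)
  qed
  have key: "\<exists>s t. 0 < s \<and> s < h \<and> 0 < t \<and> t < h \<and>
      f (x + h *\<^sub>R d + h *\<^sub>R c) - f (x + h *\<^sub>R d) - (f (x + h *\<^sub>R c) - f x)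
        = h * h * partial_deriv c (partial_deriv d f) (x + s *\<^sub>R d + t *\<^sub>R c)"
    if h: "h > 0" and cd: "c \<in> Basis" "d \<in> Basis" for h c d
  proof -
    let ?g = "\<lambda>s. f ((x + h *\<^sub>R c) + s *\<^sub>R d) - f (x + s *\<^sub>R d)"
    have "(?g has_real_derivative (partial_deriv d f ((x + h *\<^sub>R c) + s *\<^sub>R d)
        - partial_deriv d f (x + s *\<^sub>R d))) (at s)" for s
      by (intro DERIV_diff dir f' cd)
    from MVT2[OF h this] obtain s where s: "0 < s" "s < h"
      "?g h - ?g 0 = (h - 0) * (partial_deriv d f ((x + h *\<^sub>R c) + s *\<^sub>R d)
        - partial_deriv d f (x + s *\<^sub>R d))" by blast
    have "((\<lambda>t. partial_deriv d f ((x + s *\<^sub>R d) + t *\<^sub>R c)) has_real_derivative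
      partial_deriv c (partial_deriv d f) ((x + s *\<^sub>R d) + t *\<^sub>R c)) (at t)" for t
      by (intro dir f'' cd)
    from MVT2[OF h this] obtain t where t: "0 < t" "t < h"
      "partial_deriv d f ((x + s *\<^sub>R d) + h *\<^sub>R c) - partial_deriv d f ((x + s *\<^sub>R d) + 0 *\<^sub>R c)
        = (h - 0) * partial_deriv c (partial_deriv d f) ((x + s *\<^sub>R d) + t *\<^sub>R c)" by blast
    have "f (x + h *\<^sub>R d + h *\<^sub>R c) - f (x + h *\<^sub>R d) - (f (x + h *\<^sub>R c) - f x)
        = h * h * partial_deriv c (partial_deriv d f) (x + s *\<^sub>R d + t *\<^sub>R c)"
      using s(3) t(3) by (simp add: algebra_simps)
    with s t show ?thesis by blast
  qed
  have "\<bar>partial_deriv a (partial_deriv b f) x - partial_deriv b (partial_deriv a f) x\<bar> \<le> e"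
    if e: "e > 0" for e :: real
  proof -
    from cont[OF a b] e obtain d1 where d1: "d1 > 0"
      "\<And>y. dist y x < d1 \<Longrightarrow> dist (partial_deriv a (partial_deriv b f) y) (partial_deriv a (partial_deriv b f) x) < e/2"
      unfolding continuous_on_iff by (metis UNIV_I half_gt_zero)
    from cont[OF b a] e obtain d2 where d2: "d2 > 0"
      "\<And>y. dist y x < d2 \<Longrightarrow> dist (partial_deriv b (partial_deriv a f) y) (partial_deriv b (partial_deriv a f) x) < e/2"
      unfolding continuous_on_iff by (metis UNIV_I half_gt_zero)
    \<comment> \<open>The intermediate points of both orders lie at distance less than 2 h from
      \<open>x\<close>, hence within \<open>d1\<close> and \<open>d2\<close>.\<close>
    define h where "h = min d1 d2 / 2"
    have h: "h > 0" "2 * h \<le> d1" "2 * h \<le> d2" using d1 d2 by (auto simp: h_def)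
    have near: "dist (x + s *\<^sub>R c + t *\<^sub>R d) x < 2 * h"
      if "0 < s" "s < h" "0 < t" "t < h" "c \<in> Basis" "d \<in> Basis" for s t c d
    proof -
      have "dist (x + s *\<^sub>R c + t *\<^sub>R d) x = norm (s *\<^sub>R c + t *\<^sub>R d)"
        by (simp add: dist_norm algebra_simps)
      also have "\<dots> \<le> norm (s *\<^sub>R c) + norm (t *\<^sub>R d)" by (rule norm_triangle_ineq)
      also have "\<dots> < 2 * h" using that by simp
      finally show ?thesis .
    qed
    obtain s t where st: "0 < s" "s < h" "0 < t" "t < h"
      "f (x + h *\<^sub>R b + h *\<^sub>R a) - f (x + h *\<^sub>R b) - (f (x + h *\<^sub>R a) - f x)
        = h * h * partial_deriv a (partial_deriv b f) (x + s *\<^sub>R b + t *\<^sub>R a)"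
      using key[OF h(1) a b] by blast
    obtain s' t' where st': "0 < s'" "s' < h" "0 < t'" "t' < h"
      "f (x + h *\<^sub>R a + h *\<^sub>R b) - f (x + h *\<^sub>R a) - (f (x + h *\<^sub>R b) - f x)
        = h * h * partial_deriv b (partial_deriv a f) (x + s' *\<^sub>R a + t' *\<^sub>R b)"
      using key[OF h(1) b a] by blast
    have "h * h * partial_deriv a (partial_deriv b f) (x + s *\<^sub>R b + t *\<^sub>R a)
        = h * h * partial_deriv b (partial_deriv a f) (x + s' *\<^sub>R a + t' *\<^sub>R b)"
      unfolding st(5)[symmetric] st'(5)[symmetric] by (simp add: add_ac)
    then have "partial_deriv a (partial_deriv b f) (x + s *\<^sub>R b + t *\<^sub>R a)
        = partial_deriv b (partial_deriv a f) (x + s' *\<^sub>R a + t' *\<^sub>R b)" using h by simp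
    moreover have "dist (partial_deriv a (partial_deriv b f) (x + s *\<^sub>R b + t *\<^sub>R a))
        (partial_deriv a (partial_deriv b f) x) < e/2"
      using near[of s t b a] st a b h by (intro d1) auto
    moreover have "dist (partial_deriv b (partial_deriv a f) (x + s' *\<^sub>R a + t' *\<^sub>R b))
        (partial_deriv b (partial_deriv a f) x) < e/2"
      using near[of s' t' a b] st' a b h by (intro d2) auto
    ultimately show ?thesis unfolding dist_real_def abs_less_iff abs_le_iff by linarith
  qed
  note le = this
  show ?thesis
  proof (rule ccontr)
    assume "\<not> ?thesis"
    then have pos: "0 < \<bar>partial_deriv a (partial_deriv b f) x - partial_deriv b (partial_deriv a f) x\<bar> / 2"
      by simp
    show False using le[OF pos] pos by simp
  qed
qed

section \<open>Bump functions, integration by parts and Gaussians\<close>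

text \<open>The standard smooth function that is flat at 0. The polynomial parameter makes the
  family closed under differentiation, so one derivative formula yields derivatives of all
  orders.\<close>

definition flat_exp :: "real poly \<Rightarrow> real \<Rightarrow> real" where
  "flat_exp p x = (if x > 0 then poly p (inverse x) * exp (- inverse x) else 0)"

lemma tendsto_poly_mult_exp_minus_at_top:
  fixes p :: "real poly"
  shows "((\<lambda>y. poly p y * exp (- y)) \<longlongrightarrow> 0) at_top"
proof -
  have "((\<lambda>y. \<Sum>i\<le>degree p. coeff p i * (y ^ i / exp y)) \<longlongrightarrow> (\<Sum>i\<le>degree p. coeff p i * 0)) at_top"
    by (intro tendsto_sum tendsto_mult tendsto_const tendsto_power_div_exp_0)
  then show ?thesis by (simp add: poly_altdef sum_distrib_right exp_minus divide_inverse mult.assoc)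
qed

lemma flat_exp_tendsto_0: "(flat_exp p \<longlongrightarrow> 0) (at 0)"
proof -
  have "((\<lambda>x. poly p (inverse x) * exp (- inverse x)) \<longlongrightarrow> 0) (at_right 0)"
    by (rule filterlim_compose[OF tendsto_poly_mult_exp_minus_at_top filterlim_inverse_at_top_right])
  moreover have "eventually (\<lambda>x. poly p (inverse x) * exp (- inverse x) = flat_exp p x) (at_right 0)"
    by (auto simp: flat_exp_def eventually_at_filter)
  ultimately have "(flat_exp p \<longlongrightarrow> 0) (at_right 0)" by (rule Lim_transform_eventually)
  moreover have "eventually (\<lambda>x. 0 = flat_exp p x) (at_left 0)"
    by (auto simp: flat_exp_def eventually_at_filter)
  then have "(flat_exp p \<longlongrightarrow> 0) (at_left 0)" by (rule Lim_transform_eventually[OF tendsto_const])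
  ultimately show ?thesis using filterlim_split_at by blast
qed

text \<open>With y = 1 / x, the derivative of p(y) exp(-y) in x is y^2 (p(y) - p'(y)) exp(-y); the
  polynomial \<open>[:0, 0, 1:]\<close> is the factor y^2.\<close>

lemma flat_exp_has_derivative:
  "(flat_exp p has_real_derivative flat_exp ([:0, 0, 1:] * (p - pderiv p)) x) (at x)"
proof (cases x "0::real" rule: linorder_cases)
  case less
  have "((\<lambda>x. 0) has_real_derivative flat_exp ([:0, 0, 1:] * (p - pderiv p)) x) (at x)"
    using less by (simp add: flat_exp_def)
  then show ?thesis
    by (rule has_field_derivative_transform_within_open[of _ _ _ "{..<0}"])
      (use less in \<open>auto simp: flat_exp_def\<close>)
next
  case greater
  have "((\<lambda>x. poly p (inverse x) * exp (- inverse x)) has_real_derivative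
      flat_exp ([:0, 0, 1:] * (p - pderiv p)) x) (at x)"
    using greater
    by (auto intro!: derivative_eq_intros DERIV_chain2[OF poly_DERIV]
        simp: flat_exp_def field_simps power2_eq_square)
  then show ?thesis
    by (rule has_field_derivative_transform_within_open[of _ _ _ "{0<..}"])
      (use greater in \<open>auto simp: flat_exp_def\<close>)
next
  case equal
  \<comment> \<open>Dividing by h multiplies the polynomial in 1 / h by its variable, so the
    difference quotient at 0 belongs to the same family and tends to 0.\<close>
  have "flat_exp (pCons 0 p) h = (flat_exp p (0 + h) - flat_exp p 0) / h" for h
    by (auto simp: flat_exp_def divide_inverse)
  then have "((\<lambda>h. (flat_exp p (0 + h) - flat_exp p 0) / h) \<longlongrightarrow> 0) (at 0)"
    using flat_exp_tendsto_0[of "pCons 0 p"] by presburger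
  then show ?thesis using equal by (simp add: DERIV_def flat_exp_def)
qed

lemma flat_exp_1:
  "x > 0 \<Longrightarrow> flat_exp 1 x > 0" "x \<le> 0 \<Longrightarrow> flat_exp 1 x = 0" "flat_exp 1 x \<ge> 0"
  by (auto simp: flat_exp_def)

lemma flat_exp_1_mono: "x \<le> y \<Longrightarrow> flat_exp 1 x \<le> flat_exp 1 y"
  by (auto simp: flat_exp_def le_imp_inverse_le)

lemma continuous_on_flat_exp [continuous_intros]:
  "continuous_on S f \<Longrightarrow> continuous_on S (\<lambda>x. flat_exp p (f x))"
  using flat_exp_has_derivative DERIV_isCont
  by (blast intro: continuous_on_compose2[of UNIV "flat_exp p"] continuous_at_imp_continuous_on)

lemma smooth_on_flat_exp:
  assumes "open S" "smooth_on S f"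
  shows "smooth_on S (\<lambda>x. flat_exp p (f x))"
proof -
  define P where "P i = ((\<lambda>q. [:0, 0, 1:] * (q - pderiv q)) ^^ i) p" for i
  have "(flat_exp (P i) has_real_derivative flat_exp (P (Suc i)) x) (at x)" for i x
    using flat_exp_has_derivative[of "P i" x] by (simp add: P_def)
  from smooth_on_compose[OF assms(1), of "\<lambda>i. flat_exp (P i)" f 0, OF this assms(2)]
  show ?thesis by (simp add: P_def)
qed

section \<open>Radial cutoff functions\<close>

definition bump :: "'a::euclidean_space \<Rightarrow> real \<Rightarrow> 'a \<Rightarrow> real" where
  "bump p r x = flat_exp 1 (1 - inverse (r\<^sup>2) * (norm (x - p))\<^sup>2)"

lemma smooth_on_bump: "smooth_on UNIV (bump p r)"
  unfolding bump_def
  by (intro smooth_on_flat_exp smooth_on_diff smooth_on_mult smooth_on_norm_power2) auto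

lemma bump_nonneg: "bump p r x \<ge> 0"
  by (simp add: bump_def flat_exp_1)

lemma bump_support:
  assumes "r > 0"
  shows "bump p r x > 0 \<longleftrightarrow> x \<in> ball p r"
proof -
  have "inverse (r\<^sup>2) * (norm (x - p))\<^sup>2 < 1 \<longleftrightarrow> (norm (x - p))\<^sup>2 < r\<^sup>2"
    using assms by (simp add: field_simps)
  also have "\<dots> \<longleftrightarrow> x \<in> ball p r"
    using assms power_mono_iff[of r "norm (x - p)" 2]
    by (simp add: dist_norm norm_minus_commute[of p x] not_le[symmetric])
  finally show ?thesis
    using flat_exp_1[of "1 - inverse (r\<^sup>2) * (norm (x - p))\<^sup>2"] unfolding bump_def by linarith
qed

section \<open>Compact supports, translations and integration by parts\<close>

lemma partial_deriv_outside_support: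
  assumes "closed K" "\<And>x. x \<notin> K \<Longrightarrow> f x = 0" "x \<notin> K"
  shows "partial_deriv b f x = 0"
  using partial_deriv_cong_open(2)[of "- K" x "\<lambda>x. 0" f b] assms by auto

text \<open>A bridge between the Lebesgue integral over the whole space and the gauge integral over
  a box, where the Leibniz rule for parameter integrals is applied.\<close>

lemma
  fixes f :: "'a::euclidean_space \<Rightarrow> real"
  assumes f: "continuous_on UNIV f" and f0: "\<And>x. x \<notin> cbox a b \<Longrightarrow> f x = 0"
  shows integrable_compact_support: "integrable lborel f"
    and integral_compact_support: "(LINT x|lborel. f x) = integral (cbox a b) f"
proof -
  have eq: "(\<lambda>x. indicator (cbox a b) x *\<^sub>R f x) = f"
    using f0 by (intro ext) (auto simp: indicator_def)
  show i: "integrable lborel f"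
    using borel_integrable_compact[OF compact_cbox continuous_on_subset[OF f subset_UNIV], of a b]
    by (simp only: eq)
  have "integral UNIV (\<lambda>x. if x \<in> cbox a b then f x else 0) = integral (cbox a b) f"
    by (rule integral_restrict_UNIV)
  moreover have "(\<lambda>x. if x \<in> cbox a b then f x else 0) = f" using f0 by auto
  ultimately show "(LINT x|lborel. f x) = integral (cbox a b) f"
    using integral_lborel[OF i] by simp
qed

lemma compact_subset_cbox:
  fixes K :: "'a::euclidean_space set"
  assumes "compact K"
  obtains a b where "K \<subseteq> cbox a b"
  using bounded_subset_cbox_symmetric[OF compact_imp_bounded[OF assms]] by blast

lemma integral_lborel_shift:
  fixes f :: "'a::euclidean_space \<Rightarrow> real"
  shows "(LINT x|lborel. f (x + c)) = (LINT x|lborel. f x)"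
proof (cases "f \<in> borel_measurable borel")
  case True
  have "(LINT x|lborel. f x) = (LINT x|distr lborel borel ((+) c). f x)"
    by (simp add: lborel_distr_plus)
  also have "\<dots> = (LINT x|lborel. f (c + x))"
    by (rule integral_distr) (use True in auto)
  finally show ?thesis by (simp add: add.commute)
next
  case False
  \<comment> \<open>Without measurability both integrals take the default value 0, so the formula
    needs no hypothesis on \<open>f\<close>.\<close>
  have "(\<lambda>x. f (x + c)) \<notin> borel_measurable borel"
  proof
    assume "(\<lambda>x. f (x + c)) \<in> borel_measurable borel"
    then have "(\<lambda>x. f ((x - c) + c)) \<in> borel_measurable borel"
      by (rule measurable_compose[rotated]) simp
    with False show False by simp
  qed
  with False have "\<not> integrable lborel f" "\<not> integrable lborel (\<lambda>x. f (x + c))"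
    using borel_measurable_integrable by auto
  then show ?thesis by (simp add: not_integrable_integral_eq)
qed

text \<open>The integral of \<open>F (x + t b)\<close> does not depend on \<open>t\<close>; differentiate at \<open>t = 0\<close>.\<close>

lemma integral_partial_deriv_eq_0:
  fixes F :: "'a::euclidean_space \<Rightarrow> real"
  assumes F: "C_k_on 1 UNIV F" and b: "b \<in> Basis"
    and K: "compact K" "\<And>x. x \<notin> K \<Longrightarrow> F x = 0"
  shows "(LINT x|lborel. partial_deriv b F x) = 0"
proof -
  have Fd: "F differentiable at x" for x using F by simp
  have Fc: "continuous_on UNIV F" using F by (rule C_k_on_continuous_on)
  have Dc: "continuous_on UNIV (partial_deriv b F)" using F b by simp
  \<comment> \<open>All translates of \<open>K\<close> by at most 1 in the direction
    \<open>b\<close>: one box containing them serves for every t near 0.\<close>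
  let ?K = "(\<lambda>(t, x). x - t *\<^sub>R b) ` ({-1..1::real} \<times> K)"
  have "compact ?K"
    by (intro compact_continuous_image compact_Times K)
      (auto simp: case_prod_unfold intro!: continuous_intros)
  then obtain l u where lu: "?K \<subseteq> cbox l u" by (rule compact_subset_cbox)
  have out: "F (x + t *\<^sub>R b) = 0" if "x \<notin> cbox l u" "t \<in> {-1<..<1}" for x t
  proof (rule K(2))
    show "x + t *\<^sub>R b \<notin> K"
    proof
      assume "x + t *\<^sub>R b \<in> K"
      then have "(x + t *\<^sub>R b) - t *\<^sub>R b \<in> ?K"
        using that(2) by (intro image_eqI[of _ _ "(t, x + t *\<^sub>R b)"]) auto
      with lu that(1) show False by auto
    qed
  qed
  have Kl: "x \<in> cbox l u" if "x \<in> K" for x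
    using out[of x 0] lu that by (auto intro!: image_eqI[of _ _ "(0, x)"] subsetD[OF lu])
  have shift: "integral (cbox l u) (\<lambda>x. F (x + t *\<^sub>R b)) = (LINT x|lborel. F x)"
    if "t \<in> {-1<..<1}" for t
    using integral_compact_support[of "\<lambda>x. F (x + t *\<^sub>R b)" l u] out[OF _ that]
    by (simp add: integral_lborel_shift continuous_on_compose2[OF Fc] continuous_intros)
  have "((\<lambda>t. integral (cbox l u) (\<lambda>x. F (x + t *\<^sub>R b))) has_real_derivative
      integral (cbox l u) (\<lambda>x. partial_deriv b F (x + 0 *\<^sub>R b))) (at 0 within {-1<..<1})"
  proof (rule leibniz_rule_field_derivative)
    fix t :: real and x :: 'a
    have "((\<lambda>t. F (x + t *\<^sub>R b)) has_derivative
        (\<lambda>h. frechet_derivative F (at (x + t *\<^sub>R b)) (h *\<^sub>R b))) (at t within {-1<..<1})"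
      by (rule has_derivative_compose[OF _ has_derivative_frechet[OF Fd]])
        (auto intro!: derivative_eq_intros)
    moreover have "(\<lambda>h. frechet_derivative F (at (x + t *\<^sub>R b)) (h *\<^sub>R b))
        = (*) (partial_deriv b F (x + t *\<^sub>R b))"
      by (simp add: fun_eq_iff partial_deriv_def linear_scale[OF linear_frechet_derivative[OF Fd]])
    ultimately show "((\<lambda>t. F (x + t *\<^sub>R b)) has_real_derivative partial_deriv b F (x + t *\<^sub>R b))
        (at t within {-1<..<1})"
      by (simp add: has_field_derivative_def)
  qed (auto intro!: integrable_continuous continuous_intros continuous_on_compose2[OF Fc]
      continuous_on_compose2[OF Dc] simp: case_prod_unfold)
  moreover have "((\<lambda>t. integral (cbox l u) (\<lambda>x. F (x + t *\<^sub>R b))) has_real_derivative 0)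
      (at 0 within {-1<..<1})"
    by (rule has_field_derivative_transform_within[of "\<lambda>t. LINT x|lborel. F x" _ _ _ 1])
      (use shift in auto)
  ultimately have "integral (cbox l u) (partial_deriv b F) = 0"
    using DERIV_unique[of "\<lambda>t. integral (cbox l u) (\<lambda>x. F (x + t *\<^sub>R b))" _ 0 0]
    by (simp add: at_within_open[of 0 "{-1<..<1::real}"])
  moreover have "partial_deriv b F x = 0" if "x \<notin> cbox l u" for x
    by (rule partial_deriv_outside_support[OF compact_imp_closed[OF K(1)]]) (use K Kl that in auto)
  ultimately show ?thesis using integral_compact_support[OF Dc, of l u] by simp
qed

lemma has_bochner_integral_gaussian:
  fixes x0 :: "'a::euclidean_space"
  assumes c: "c > 0"
  shows "has_bochner_integral lborel (\<lambda>x. exp (- (c * (norm (x - x0))\<^sup>2))) (sqrt (pi / c) ^ DIM('a))"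
proof -
  have one: "(\<integral>\<^sup>+x. ennreal (exp (- (c * (x - m)\<^sup>2))) \<partial>lborel) = ennreal (sqrt (pi / c))" for m
  proof -
    \<comment> \<open>The standard deviation for which the normal density has exponent - c (x -
      m)^2; its normalising factor is then sqrt (pi / c).\<close>
    define s where "s = sqrt (1 / (2 * c))"
    have s: "s > 0" "s\<^sup>2 = 1 / (2 * c)" using c by (auto simp: s_def)
    have eq: "exp (- (c * (x - m)\<^sup>2)) = sqrt (pi / c) * normal_density m s x" for x
      using c by (simp add: normal_density_def s field_simps real_sqrt_mult real_sqrt_divide)
    have "(\<integral>\<^sup>+x. ennreal (normal_density m s x) \<partial>lborel) = ennreal 1"
      using s by (subst nn_integral_eq_integral) auto
    then show ?thesis
      unfolding eq using c
      by (simp add: ennreal_mult normal_density_nonneg nn_integral_cmult)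
  qed
  have prod: "ennreal (exp (- (c * (norm (x - x0))\<^sup>2)))
      = (\<Prod>b\<in>Basis. ennreal (exp (- (c * (x \<bullet> b - x0 \<bullet> b)\<^sup>2))))" for x :: 'a
  proof -
    have "(norm (x - x0))\<^sup>2 = (\<Sum>b\<in>Basis. (x \<bullet> b - x0 \<bullet> b)\<^sup>2)"
      unfolding power2_norm_eq_inner
      by (subst euclidean_inner) (simp only: inner_diff_left power2_eq_square)
    then have "exp (- (c * (norm (x - x0))\<^sup>2)) = (\<Prod>b\<in>Basis. exp (- (c * (x \<bullet> b - x0 \<bullet> b)\<^sup>2)))"
      by (simp add: sum_distrib_left sum_negf[symmetric] exp_sum)
    then show ?thesis by (simp add: prod_ennreal)
  qed
  have "(\<integral>\<^sup>+x. ennreal (exp (- (c * (norm (x - x0))\<^sup>2))) \<partial>lborel)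
      = (\<Prod>b\<in>(Basis :: 'a set). \<integral>\<^sup>+x. ennreal (exp (- (c * (x - x0 \<bullet> b)\<^sup>2))) \<partial>lborel)"
    unfolding prod by (rule nn_integral_lborel_prod) auto
  also have "\<dots> = ennreal (sqrt (pi / c) ^ DIM('a))"
    using c by (simp add: one ennreal_power)
  finally show ?thesis
    using c by (intro has_bochner_integral_nn_integral) auto
qed

section \<open>Growth at infinity\<close>

text \<open>The base is at least 1, so the bound increases with the exponent, and two bounds can be
  brought to a common exponent when functions are added.\<close>

definition poly_growth :: "('a::real_normed_vector \<Rightarrow> real) \<Rightarrow> bool" where
  "poly_growth f \<longleftrightarrow> (\<exists>C k. \<forall>x. \<bar>f x\<bar> \<le> C * (1 + (norm x)\<^sup>2) ^ k)"

lemma poly_growthI: "(\<And>x. \<bar>f x\<bar> \<le> C * (1 + (norm x)\<^sup>2) ^ k) \<Longrightarrow> poly_growth f"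
  unfolding poly_growth_def by blast

lemma poly_growthE:
  assumes "poly_growth f"
  obtains C k where "C \<ge> 0" "\<And>x. \<bar>f x\<bar> \<le> C * (1 + (norm x)\<^sup>2) ^ k"
proof -
  obtain C k where C: "\<And>x. \<bar>f x\<bar> \<le> C * (1 + (norm x)\<^sup>2) ^ k"
    using assms unfolding poly_growth_def by blast
  from order_trans[OF abs_ge_zero C[of 0]] have "C \<ge> 0" by simp
  with C show ?thesis using that by blast
qed

lemma poly_growth_const: "poly_growth (\<lambda>x. c)"
  by (rule poly_growthI[of _ "\<bar>c\<bar>" 0]) simp

lemma poly_growth_inner: "poly_growth (\<lambda>x::'a::real_inner. x \<bullet> b)"
proof (rule poly_growthI[of _ "norm b" 1])
  fix x :: 'a
  have "0 \<le> (norm x - 1)\<^sup>2 + (norm x)\<^sup>2 + 1" by simp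
  then have "norm x \<le> 1 + (norm x)\<^sup>2" by (simp add: power2_eq_square algebra_simps)
  then have "norm x * norm b \<le> (1 + (norm x)\<^sup>2) * norm b" by (rule mult_right_mono) simp
  with Cauchy_Schwarz_ineq2[of x b] show "\<bar>x \<bullet> b\<bar> \<le> norm b * (1 + (norm x)\<^sup>2) ^ 1"
    by (simp add: mult.commute)
qed

lemma poly_growth_mult:
  assumes "poly_growth f" "poly_growth g"
  shows "poly_growth (\<lambda>x. f x * g x)"
proof -
  obtain C k where C: "C \<ge> 0" "\<And>x. \<bar>f x\<bar> \<le> C * (1 + (norm x)\<^sup>2) ^ k"
    using assms(1) by (rule poly_growthE) blast
  obtain D l where D: "D \<ge> 0" "\<And>x. \<bar>g x\<bar> \<le> D * (1 + (norm x)\<^sup>2) ^ l"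
    using assms(2) by (rule poly_growthE) blast
  have "\<bar>f x * g x\<bar> \<le> (C * D) * (1 + (norm x)\<^sup>2) ^ (k + l)" for x
    using mult_mono[OF C(2)[of x] D(2)[of x]] C(1) by (simp add: abs_mult power_add mult_ac)
  then show ?thesis by (rule poly_growthI)
qed

lemma poly_growth_add:
  assumes "poly_growth f" "poly_growth g"
  shows "poly_growth (\<lambda>x. f x + g x)"
proof -
  obtain C k where C: "C \<ge> 0" "\<And>x. \<bar>f x\<bar> \<le> C * (1 + (norm x)\<^sup>2) ^ k"
    using assms(1) by (rule poly_growthE) blast
  obtain D l where D: "D \<ge> 0" "\<And>x. \<bar>g x\<bar> \<le> D * (1 + (norm x)\<^sup>2) ^ l"
    using assms(2) by (rule poly_growthE) blast
  have "\<bar>f x + g x\<bar> \<le> (C + D) * (1 + (norm x)\<^sup>2) ^ (k + l)" for x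
  proof -
    have "C * (1 + (norm x)\<^sup>2) ^ k \<le> C * (1 + (norm x)\<^sup>2) ^ (k + l)"
      "D * (1 + (norm x)\<^sup>2) ^ l \<le> D * (1 + (norm x)\<^sup>2) ^ (k + l)"
      using C(1) D(1) by (auto intro!: mult_left_mono power_increasing)
    with C(2)[of x] D(2)[of x] show ?thesis by (simp add: distrib_right)
  qed
  then show ?thesis by (rule poly_growthI)
qed

lemma poly_growth_diff: "poly_growth f \<Longrightarrow> poly_growth g \<Longrightarrow> poly_growth (\<lambda>x. f x - g x)"
  using poly_growth_add[OF _ poly_growth_mult[OF poly_growth_const[of "-1"]], of f g] by simp

lemma poly_growth_sum: "(\<And>i. i \<in> I \<Longrightarrow> poly_growth (f i)) \<Longrightarrow> poly_growth (\<lambda>x. \<Sum>i\<in>I. f i x)"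
  by (induction I rule: infinite_finite_induct) (auto intro: poly_growth_add poly_growth_const)

lemmas poly_growth_intros =
  poly_growth_const poly_growth_inner poly_growth_mult poly_growth_add poly_growth_diff poly_growth_sum

lemma continuous_bounded_cball:
  fixes f :: "'a::euclidean_space \<Rightarrow> real"
  assumes "continuous_on UNIV f"
  shows "\<exists>B. \<forall>x. norm x \<le> r \<longrightarrow> \<bar>f x\<bar> \<le> B"
proof -
  have "bounded (f ` cball 0 r)"
    using assms by (intro compact_imp_bounded compact_continuous_image)
      (auto intro: continuous_on_subset)
  then obtain B where "\<forall>y\<in>f ` cball 0 r. norm y \<le> B" unfolding bounded_iff by blast
  then show ?thesis by (intro exI[of _ B]) simp
qed

lemma poly_growth_outside_ball:
  fixes f :: "'a::euclidean_space \<Rightarrow> real"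
  assumes "continuous_on UNIV f" "M \<ge> 0" "\<And>x. norm x \<ge> 1 \<Longrightarrow> \<bar>f x\<bar> \<le> M * (norm x)\<^sup>2"
  shows "poly_growth f"
proof -
  obtain B where B: "\<And>x. norm x \<le> 1 \<Longrightarrow> \<bar>f x\<bar> \<le> B"
    using continuous_bounded_cball[OF assms(1)] by blast
  from order_trans[OF abs_ge_zero B[of 0]] have "B \<ge> 0" by simp
  show ?thesis
  proof (rule poly_growthI[of _ "B + M" 1])
    fix x :: 'a
    have eq: "(B + M) * (1 + (norm x)\<^sup>2) ^ 1 = B + M + B * (norm x)\<^sup>2 + M * (norm x)\<^sup>2"
      by (simp add: algebra_simps)
    have nn: "0 \<le> M * (norm x)\<^sup>2" "0 \<le> B * (norm x)\<^sup>2"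
      using \<open>B \<ge> 0\<close> assms(2) by simp_all
    show "\<bar>f x\<bar> \<le> (B + M) * (1 + (norm x)\<^sup>2) ^ 1"
    proof (cases "norm x \<le> 1")
      case True
      from B[OF True] nn assms(2) show ?thesis unfolding eq by linarith
    next
      case False
      then have "\<bar>f x\<bar> \<le> M * (norm x)\<^sup>2" by (intro assms(3)) simp
      with nn assms(2) \<open>B \<ge> 0\<close> show ?thesis unfolding eq by linarith
    qed
  qed
qed

text \<open>Half of the Gaussian decay absorbs the polynomial factor, and the other half gives an
  integrable majorant.\<close>

lemma integrable_poly_growth_exp:
  fixes f \<phi> :: "'a::euclidean_space \<Rightarrow> real"
  assumes f: "continuous_on UNIV f" "poly_growth f"
    and \<phi>: "continuous_on UNIV \<phi>" and a: "a > 0" and low: "\<And>x. \<phi> x \<ge> a * (norm x)\<^sup>2 - C"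
  shows "integrable lborel (\<lambda>x. f x * exp (- \<phi> x))"
proof -
  obtain D k where D: "D \<ge> 0" "\<And>x. \<bar>f x\<bar> \<le> D * (1 + (norm x)\<^sup>2) ^ k"
    using f(2) by (rule poly_growthE) blast
  \<comment> \<open>The successor keeps the exponent positive, so that \<open>q\<close> is well
    defined. The choice of \<open>q\<close> makes the m-th power of exp (q (1 + |x|^2)) equal to exp
    (a / 2 (1 + |x|^2)).\<close>
  define m where "m = Suc k"
  define q where "q = a / (2 * real m)"
  have "real m > 0" by (simp add: m_def)
  then have q: "q > 0" "q * real m = a / 2" using a by (auto simp: q_def)
  have bound: "norm (f x * exp (- \<phi> x))
      \<le> norm (D * inverse q ^ m * exp (a / 2 + C) * exp (- (a / 2 * (norm (x - 0))\<^sup>2)))" for x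
  proof -
    let ?N = "1 + (norm x)\<^sup>2"
    have "q * ?N \<le> exp (q * ?N)" using exp_ge_add_one_self[of "q * ?N"] by linarith
    then have "(q * ?N) ^ m \<le> exp (q * ?N) ^ m" using q by (intro power_mono) auto
    also have "\<dots> = exp ((q * real m) * ?N)"
      by (simp only: exp_of_nat_mult[symmetric] mult_ac)
    also have "\<dots> = exp (a / 2 * ?N)" by (simp only: q(2))
    finally have "inverse q ^ m * (q * ?N) ^ m \<le> inverse q ^ m * exp (a / 2 * ?N)"
      using q(1) by (intro mult_left_mono) auto
    moreover have "inverse q ^ m * (q * ?N) ^ m = ?N ^ m"
      using q(1) by (simp only: power_mult_distrib[symmetric] mult.assoc[symmetric]) simp
    ultimately have "?N ^ m \<le> inverse q ^ m * exp (a / 2 * ?N)" by simp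
    moreover have "?N ^ k \<le> ?N ^ m" by (intro power_increasing) (auto simp: m_def)
    ultimately have "D * ?N ^ k \<le> D * (inverse q ^ m * exp (a / 2 * ?N))"
      using D(1) by (intro mult_left_mono) auto
    with D(2)[of x] have "\<bar>f x\<bar> \<le> D * (inverse q ^ m * exp (a / 2 * ?N))" by linarith
    moreover have "exp (- \<phi> x) \<le> exp (C - a * (norm x)\<^sup>2)" using low[of x] by simp
    ultimately have "\<bar>f x\<bar> * exp (- \<phi> x)
        \<le> D * (inverse q ^ m * exp (a / 2 * ?N)) * exp (C - a * (norm x)\<^sup>2)"
      using D(1) q(1) by (intro mult_mono) auto
    also have "\<dots> = D * inverse q ^ m * (exp (a / 2 * ?N) * exp (C - a * (norm x)\<^sup>2))" by simp
    also have "exp (a / 2 * ?N) * exp (C - a * (norm x)\<^sup>2)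
        = exp (a / 2 + C) * exp (- (a / 2 * (norm (x - 0))\<^sup>2))"
      by (simp add: exp_add[symmetric] algebra_simps)
    finally show ?thesis using D(1) q(1) by (simp add: abs_mult mult.assoc)
  qed
  have "integrable lborel (\<lambda>x::'a. D * inverse q ^ m * exp (a / 2 + C) * exp (- (a / 2 * (norm (x - 0))\<^sup>2)))"
    using a by (intro integrable_mult_right integrable.intros[OF has_bochner_integral_gaussian]) simp
  moreover have "(\<lambda>x. f x * exp (- \<phi> x)) \<in> borel_measurable lborel"
    by (auto intro!: borel_measurable_continuous_onI continuous_intros f \<phi>)
  ultimately show ?thesis
    by (rule Bochner_Integration.integrable_bound) (use bound in auto)
qed

section \<open>Inversion in the unit sphere\<close>

definition inversion :: "'a::real_inner \<Rightarrow> 'a" where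
  "inversion y = inverse (y \<bullet> y) *\<^sub>R y"

text \<open>The Euler operator, r times the derivative in r.\<close>

definition radial_deriv :: "('a::euclidean_space \<Rightarrow> real) \<Rightarrow> 'a \<Rightarrow> real" where
  "radial_deriv h z = (\<Sum>b\<in>Basis. (z \<bullet> b) * partial_deriv b h z)"

lemma norm_inversion: "norm (inversion y) = inverse (norm y)"
  by (cases "y = 0") (simp_all add: inversion_def power2_norm_eq_inner[symmetric] power2_eq_square)

text \<open>The convention \<open>inverse 0 = 0\<close> fixes the origin, so the involution property
  holds without exception.\<close>

lemma inversion_inversion: "inversion (inversion y) = y"
  by (cases "y = 0") (simp_all add: inversion_def field_simps)

lemma radial_deriv_eq:
  assumes "h differentiable at z"
  shows "radial_deriv h z = frechet_derivative h (at z) z"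
proof -
  have "frechet_derivative h (at z) (\<Sum>b\<in>Basis. (z \<bullet> b) *\<^sub>R b) = radial_deriv h z"
    using linear_frechet_derivative[OF assms]
    by (simp add: linear_sum linear_scale radial_deriv_def partial_deriv_def)
  then show ?thesis by (simp add: euclidean_representation)
qed

text \<open>The differential of the inversion at \<open>y\<close> is
  \<open>inverse (y \<bullet> y)\<close> times the reflection in the hyperplane orthogonal to
  \<open>y\<close>. Writing the reflected part as a multiple of \<open>inversion y\<close> turns it
  into the Euler operator at the image point.\<close>

lemma
  fixes h :: "'a::euclidean_space \<Rightarrow> real"
  assumes h: "\<And>z. h differentiable at z" and y: "y \<noteq> 0"
  shows differentiable_inversion: "(\<lambda>y. h (inversion y)) differentiable at y"
    and partial_deriv_inversion: "partial_deriv b (\<lambda>y. h (inversion y)) y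
      = inverse (y \<bullet> y) * (partial_deriv b h (inversion y) - 2 * (y \<bullet> b) * radial_deriv h (inversion y))"
proof -
  let ?L = "frechet_derivative h (at (inversion y))"
  have L: "linear ?L" by (rule linear_frechet_derivative[OF h])
  have "((\<lambda>y. inverse (y \<bullet> y) *\<^sub>R y) has_derivative
      (\<lambda>v. inverse (y \<bullet> y) *\<^sub>R v - (2 * (y \<bullet> v) * (inverse (y \<bullet> y))\<^sup>2) *\<^sub>R y)) (at y)"
    using y by (auto intro!: derivative_eq_intros simp: inner_commute power2_eq_square field_simps)
  from has_derivative_compose[OF this, of h ?L] has_derivative_frechet[OF h, of "inversion y"]
  have d: "((\<lambda>y. h (inversion y)) has_derivative
      (\<lambda>v. ?L (inverse (y \<bullet> y) *\<^sub>R v - (2 * (y \<bullet> v) * (inverse (y \<bullet> y))\<^sup>2) *\<^sub>R y))) (at y)"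
    by (simp add: inversion_def)
  then show "(\<lambda>y. h (inversion y)) differentiable at y" by (rule differentiableI)
  have "?L (inverse (y \<bullet> y) *\<^sub>R b - (2 * (y \<bullet> b) * (inverse (y \<bullet> y))\<^sup>2) *\<^sub>R y)
      = ?L (inverse (y \<bullet> y) *\<^sub>R b - (2 * (y \<bullet> b) * inverse (y \<bullet> y)) *\<^sub>R inversion y)"
    by (simp add: inversion_def power2_eq_square mult_ac)
  also have "\<dots> = inverse (y \<bullet> y) * ?L b - 2 * (y \<bullet> b) * inverse (y \<bullet> y) * ?L (inversion y)"
    using L by (simp add: linear_diff linear_scale)
  finally show "partial_deriv b (\<lambda>y. h (inversion y)) y
      = inverse (y \<bullet> y) * (partial_deriv b h (inversion y) - 2 * (y \<bullet> b) * radial_deriv h (inversion y))"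
    using partial_deriv_eqI[OF d, of b]
    by (simp add: radial_deriv_eq[OF h] partial_deriv_def[of b h] algebra_simps)
qed

lemma bounded_inversion:
  fixes h :: "'a::euclidean_space \<Rightarrow> real"
  assumes "continuous_on UNIV h"
  obtains M where "M \<ge> 0" "\<And>y. norm y \<ge> 1 \<Longrightarrow> \<bar>h (inversion y)\<bar> \<le> M"
proof -
  obtain B where B: "\<And>x. norm x \<le> 1 \<Longrightarrow> \<bar>h x\<bar> \<le> B"
    using continuous_bounded_cball[OF assms] by blast
  show ?thesis
  proof
    show "B \<ge> 0" using order_trans[OF abs_ge_zero B[of 0]] by simp
    show "\<bar>h (inversion y)\<bar> \<le> B" if "norm y \<ge> 1" for y
      using that by (intro B) (simp add: norm_inversion inverse_le_1_iff)
  qed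
qed

lemma continuous_on_radial_deriv:
  "C_k_on 1 UNIV h \<Longrightarrow> continuous_on UNIV (radial_deriv h)"
  unfolding radial_deriv_def by (auto intro!: continuous_intros)

text \<open>Outside the unit ball \<open>inversion y\<close> stays in the unit ball, where
  \<open>h\<close> and its first derivatives are bounded, and \<open>inverse (y \<bullet> y)\<close>
  compensates the factor \<open>y \<bullet> b\<close>, which is at most \<open>y \<bullet> y\<close>
  there.\<close>

lemma bounded_partial_deriv_inversion:
  fixes h :: "'a::euclidean_space \<Rightarrow> real"
  assumes h: "C_k_on 1 UNIV h" and b: "b \<in> Basis"
  obtains M where "M \<ge> 0" "\<And>y. norm y \<ge> 1 \<Longrightarrow> \<bar>partial_deriv b (\<lambda>y. h (inversion y)) y\<bar> \<le> M"
proof -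
  obtain M1 where M1: "M1 \<ge> 0" "\<And>y. norm y \<ge> 1 \<Longrightarrow> \<bar>partial_deriv b h (inversion y)\<bar> \<le> M1"
    using bounded_inversion[of "partial_deriv b h"] h b by auto
  obtain M2 where M2: "M2 \<ge> 0" "\<And>y. norm y \<ge> 1 \<Longrightarrow> \<bar>radial_deriv h (inversion y)\<bar> \<le> M2"
    using bounded_inversion[OF continuous_on_radial_deriv[OF h]] by blast
  show ?thesis
  proof
    show "M1 + 2 * M2 \<ge> 0" using M1 M2 by simp
    fix y :: 'a assume y: "norm y \<ge> 1"
    have N: "1 \<le> y \<bullet> y" using y by (simp add: norm_eq_sqrt_inner)
    have "\<bar>y \<bullet> b\<bar> \<le> norm y" using Basis_le_norm[OF b] by blast
    also have "\<dots> \<le> norm y * norm y" using mult_right_mono[OF y, of "norm y"] by simp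
    finally have yb: "\<bar>y \<bullet> b\<bar> \<le> y \<bullet> y" by (simp add: norm_eq_sqrt_inner)
    have "\<bar>partial_deriv b h (inversion y) - 2 * (y \<bullet> b) * radial_deriv h (inversion y)\<bar>
        \<le> \<bar>partial_deriv b h (inversion y)\<bar> + 2 * (\<bar>y \<bullet> b\<bar> * \<bar>radial_deriv h (inversion y)\<bar>)"
      using abs_triangle_ineq4[of "partial_deriv b h (inversion y)" "2 * (y \<bullet> b) * radial_deriv h (inversion y)"]
      by (simp add: abs_mult)
    also have "\<dots> \<le> M1 * (y \<bullet> y) + 2 * ((y \<bullet> y) * M2)"
    proof -
      have "\<bar>partial_deriv b h (inversion y)\<bar> * 1 \<le> M1 * (y \<bullet> y)"
        using M1 y N by (intro mult_mono) auto
      moreover have "\<bar>y \<bullet> b\<bar> * \<bar>radial_deriv h (inversion y)\<bar> \<le> (y \<bullet> y) * M2"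
        using M2 y yb N by (intro mult_mono) auto
      ultimately show ?thesis by simp
    qed
    also have "\<dots> = (y \<bullet> y) * (M1 + 2 * M2)" by (simp add: algebra_simps)
    finally have "inverse (y \<bullet> y) * \<bar>partial_deriv b h (inversion y) - 2 * (y \<bullet> b) * radial_deriv h (inversion y)\<bar>
        \<le> inverse (y \<bullet> y) * ((y \<bullet> y) * (M1 + 2 * M2))"
      using N by (intro mult_left_mono) auto
    also have "y \<bullet> y > 0" using N by linarith
    then have "inverse (y \<bullet> y) * ((y \<bullet> y) * (M1 + 2 * M2)) = M1 + 2 * M2"
      by (simp add: field_simps)
    finally show "\<bar>partial_deriv b (\<lambda>y. h (inversion y)) y\<bar> \<le> M1 + 2 * M2"
      using N h y by (subst partial_deriv_inversion) (auto simp: abs_mult)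
  qed
qed

text \<open>If \<open>\<phi>\<close> is the Kelvin-type transform \<open>|y|\<^sup>2 \<psi> (y / |y|\<^sup>2)\<close>, then
  \<open>\<partial>\<^sub>b \<phi> = 2 y\<^sub>b (\<psi> - r \<partial>\<^sub>r \<psi>) (y / |y|\<^sup>2) + \<partial>\<^sub>b \<psi> (y / |y|\<^sup>2)\<close>,
  so a second derivative of \<open>\<phi>\<close> only needs first derivatives of the inversion.\<close>

lemma
  fixes \<phi> :: "'a::euclidean_space \<Rightarrow> real"
  assumes \<phi>: "C_k_on 2 UNIV \<phi>" and \<psi>: "C_k_on 2 UNIV \<psi>"
    and eq: "\<And>x. x \<noteq> 0 \<Longrightarrow> \<psi> x = (norm x)\<^sup>2 * \<phi> (x /\<^sub>R (norm x)\<^sup>2)" and pos: "\<psi> 0 > 0"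
  shows inversion_growth: "poly_growth \<phi>"
    and inversion_growth_1: "b \<in> Basis \<Longrightarrow> poly_growth (partial_deriv b \<phi>)"
    and inversion_growth_2: "b \<in> Basis \<Longrightarrow> c \<in> Basis \<Longrightarrow> poly_growth (partial_deriv c (partial_deriv b \<phi>))"
    and inversion_lower_bound: "\<exists>a>0. \<exists>C. \<forall>x. \<phi> x \<ge> a * (norm x)\<^sup>2 - C"
proof -
  have \<phi>b: "C_k_on 1 UNIV (partial_deriv b \<phi>)" if "b \<in> Basis" for b
    using \<phi> that by (simp add: numeral_2_eq_2)
  note \<phi>' = C_k_on_continuous_on[OF \<phi>] C_k_on_continuous_on[OF \<phi>b]
  have \<phi>'': "continuous_on UNIV (partial_deriv c (partial_deriv b \<phi>))"
    if "b \<in> Basis" "c \<in> Basis" for b c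
    using \<phi>b[OF that(1)] that(2) by simp
  have \<psi>1: "C_k_on 1 UNIV \<psi>" using \<psi> C_k_on_SucD by (simp only: numeral_2_eq_2 One_nat_def)
  have \<psi>d: "\<And>x. \<psi> differentiable at x" and \<psi>c: "continuous_on UNIV \<psi>"
    using \<psi>1 C_k_on_continuous_on[OF \<psi>1] by simp_all
  have \<psi>b: "C_k_on 1 UNIV (partial_deriv b \<psi>)" if "b \<in> Basis" for b
    using \<psi> that by (simp add: numeral_2_eq_2)
  \<comment> \<open>The combination that carries the linear factor in the first derivatives of
    \<open>\<phi>\<close>. It is of class C^1, so second derivatives of \<open>\<phi>\<close> can be
    taken although \<open>\<psi>\<close> is only C^2.\<close>
  define g where "g z = \<psi> z - radial_deriv \<psi> z" for z
  have g1: "C_k_on 1 UNIV g"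
  proof -
    have "C_k_on 1 UNIV (\<lambda>z. \<psi> z + (-1) * (\<Sum>b\<in>Basis. (z \<bullet> b) * partial_deriv b \<psi> z))"
      by (intro C_k_on_add C_k_on_mult C_k_on_sum C_k_on_const \<psi>1 \<psi>b open_UNIV)
        (auto simp del: C_k_on.simps One_nat_def intro!: C_k_on_bounded_linear bounded_linear_inner_left)
    also have "(\<lambda>z. \<psi> z + (-1) * (\<Sum>b\<in>Basis. (z \<bullet> b) * partial_deriv b \<psi> z)) = g"
      by (simp add: g_def radial_deriv_def fun_eq_iff)
    finally show ?thesis .
  qed
  have gd: "\<And>x. g differentiable at x" and gc: "continuous_on UNIV g"
    using g1 C_k_on_continuous_on[OF g1] by simp_all
  \<comment> \<open>The relation between \<open>\<phi>\<close> and \<open>\<psi>\<close> is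
    symmetric: it is read off at the point \<open>inversion y\<close>.\<close>
  have rep: "\<phi> y = (y \<bullet> y) * \<psi> (inversion y)" if "y \<noteq> 0" for y
  proof -
    have "inversion y \<noteq> 0" using that by (simp add: inversion_def)
    from eq[OF this] have "\<psi> (inversion y) = (norm (inversion y))\<^sup>2 * \<phi> (inversion (inversion y))"
      by (simp add: inversion_def[of "inversion y"] power2_norm_eq_inner)
    with that show ?thesis
      by (simp add: inversion_inversion norm_inversion power_inverse power2_norm_eq_inner)
  qed
  have rep1: "partial_deriv b \<phi> y = 2 * (y \<bullet> b) * g (inversion y) + partial_deriv b \<psi> (inversion y)"
    if "y \<noteq> 0" "b \<in> Basis" for y b
  proof -
    have q: "((\<lambda>y::'a. y \<bullet> y) has_derivative (\<lambda>v. 2 * (y \<bullet> v))) (at y)"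
      by (auto intro!: derivative_eq_intros simp: inner_commute)
    have "partial_deriv b \<phi> y = partial_deriv b (\<lambda>y. (y \<bullet> y) * \<psi> (inversion y)) y"
      by (rule partial_deriv_cong_open(2)[of "- {0}"])
        (use that rep in \<open>auto intro!: differentiable_mult differentiable_inversion \<psi>d differentiableI[OF q]\<close>)
    also have "\<dots> = (y \<bullet> y) * partial_deriv b (\<lambda>y. \<psi> (inversion y)) y + 2 * (y \<bullet> b) * \<psi> (inversion y)"
      using that by (subst partial_deriv_mult)
        (auto intro: differentiable_inversion \<psi>d differentiableI[OF q] simp: partial_deriv_eqI[OF q])
    also have "(y \<bullet> y) * partial_deriv b (\<lambda>y. \<psi> (inversion y)) y
        = partial_deriv b \<psi> (inversion y) - 2 * (y \<bullet> b) * radial_deriv \<psi> (inversion y)"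
      unfolding partial_deriv_inversion[OF \<psi>d that(1)] mult.assoc[symmetric] using that(1) by simp
    finally show ?thesis by (simp add: g_def algebra_simps)
  qed
  have rep2: "partial_deriv c (partial_deriv b \<phi>) y = 2 * (y \<bullet> b) * partial_deriv c (\<lambda>y. g (inversion y)) y
      + 2 * (c \<bullet> b) * g (inversion y) + partial_deriv c (\<lambda>y. partial_deriv b \<psi> (inversion y)) y"
    if "y \<noteq> 0" "b \<in> Basis" "c \<in> Basis" for y b c
  proof -
    have \<psi>bd: "\<And>z. partial_deriv b \<psi> differentiable at z" using \<psi>b that by simp
    have l: "bounded_linear (\<lambda>y. 2 * (y \<bullet> b))"
      by (intro bounded_linear_const_mult bounded_linear_inner_left)
    note ld = bounded_linear_imp_differentiable[OF l]
    have "partial_deriv c (partial_deriv b \<phi>) y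
        = partial_deriv c (\<lambda>y. 2 * (y \<bullet> b) * g (inversion y) + partial_deriv b \<psi> (inversion y)) y"
      by (rule partial_deriv_cong_open(2)[of "- {0}"])
        (use that rep1 in \<open>auto intro!: differentiable_add differentiable_mult
            differentiable_inversion gd \<psi>bd ld\<close>)
    also have "\<dots> = 2 * (y \<bullet> b) * partial_deriv c (\<lambda>y. g (inversion y)) y
      + 2 * (c \<bullet> b) * g (inversion y) + partial_deriv c (\<lambda>y. partial_deriv b \<psi> (inversion y)) y"
      using that by (simp add: partial_deriv_add partial_deriv_mult differentiable_mult
          differentiable_inversion gd \<psi>bd ld partial_deriv_bounded_linear[OF l])
    finally show ?thesis .
  qed
  have yb: "\<bar>y \<bullet> b\<bar> \<le> (norm y)\<^sup>2" if "norm y \<ge> 1" "b \<in> Basis" for y b :: 'a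
  proof -
    have "norm y \<le> norm y * norm y" using mult_right_mono[OF that(1), of "norm y"] by simp
    with Basis_le_norm[OF that(2), of y] show ?thesis by (simp add: power2_eq_square)
  qed
  obtain M0 where M0: "M0 \<ge> 0" "\<And>y. norm y \<ge> 1 \<Longrightarrow> \<bar>\<psi> (inversion y)\<bar> \<le> M0"
    using bounded_inversion[OF \<psi>c] by blast
  obtain M1 where M1: "M1 \<ge> 0" "\<And>y. norm y \<ge> 1 \<Longrightarrow> \<bar>g (inversion y)\<bar> \<le> M1"
    using bounded_inversion[OF gc] by blast
  show "poly_growth \<phi>"
  proof (rule poly_growth_outside_ball[OF \<phi>'(1) M0(1)])
    fix y :: 'a assume y: "norm y \<ge> 1"
    then have "y \<noteq> 0" by auto
    then have "\<bar>\<phi> y\<bar> = (norm y)\<^sup>2 * \<bar>\<psi> (inversion y)\<bar>"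
      by (simp add: rep abs_mult power2_norm_eq_inner)
    also have "\<dots> \<le> (norm y)\<^sup>2 * M0" using M0(2)[OF y] by (intro mult_left_mono) auto
    finally show "\<bar>\<phi> y\<bar> \<le> M0 * (norm y)\<^sup>2" by (simp add: mult.commute)
  qed
  show "poly_growth (partial_deriv b \<phi>)" if b: "b \<in> Basis"
  proof -
    obtain M2 where M2: "M2 \<ge> 0" "\<And>y. norm y \<ge> 1 \<Longrightarrow> \<bar>partial_deriv b \<psi> (inversion y)\<bar> \<le> M2"
      using bounded_inversion[OF C_k_on_continuous_on[OF \<psi>b[OF b]]] by blast
    show ?thesis
    proof (rule poly_growth_outside_ball[OF \<phi>'(2)[OF b], of "2 * M1 + M2"])
      fix y :: 'a assume y: "norm y \<ge> 1"
      then have y0: "y \<noteq> 0" by auto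
      have "\<bar>y \<bullet> b\<bar> * \<bar>g (inversion y)\<bar> \<le> (norm y)\<^sup>2 * M1"
        using M1 y yb[OF y b] by (intro mult_mono) auto
      moreover have "\<bar>partial_deriv b \<psi> (inversion y)\<bar> * 1 \<le> M2 * (norm y)\<^sup>2"
        using M2 y by (intro mult_mono) auto
      moreover have "\<bar>partial_deriv b \<phi> y\<bar> \<le> 2 * (\<bar>y \<bullet> b\<bar> * \<bar>g (inversion y)\<bar>) + \<bar>partial_deriv b \<psi> (inversion y)\<bar>"
        using abs_triangle_ineq[of "2 * (y \<bullet> b) * g (inversion y)"]
        by (simp add: rep1[OF y0 b] abs_mult mult.assoc)
      ultimately show "\<bar>partial_deriv b \<phi> y\<bar> \<le> (2 * M1 + M2) * (norm y)\<^sup>2"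
        by (simp add: algebra_simps)
    qed (use M1 M2 in auto)
  qed
  show "poly_growth (partial_deriv c (partial_deriv b \<phi>))" if b: "b \<in> Basis" and c: "c \<in> Basis"
  proof -
    obtain M2 where M2: "M2 \<ge> 0" "\<And>y. norm y \<ge> 1 \<Longrightarrow> \<bar>partial_deriv c (\<lambda>y. g (inversion y)) y\<bar> \<le> M2"
      using bounded_partial_deriv_inversion[OF g1 c] by blast
    obtain M3 where M3: "M3 \<ge> 0"
      "\<And>y. norm y \<ge> 1 \<Longrightarrow> \<bar>partial_deriv c (\<lambda>y. partial_deriv b \<psi> (inversion y)) y\<bar> \<le> M3"
      using bounded_partial_deriv_inversion[OF \<psi>b[OF b] c] by blast
    show ?thesis
    proof (rule poly_growth_outside_ball[OF \<phi>''[OF b c], of "2 * M2 + 2 * M1 + M3"])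
      fix y :: 'a assume y: "norm y \<ge> 1"
      then have y0: "y \<noteq> 0" by auto
      have N: "1 \<le> (norm y)\<^sup>2" using y by simp
      have "\<bar>y \<bullet> b\<bar> * \<bar>partial_deriv c (\<lambda>y. g (inversion y)) y\<bar> \<le> (norm y)\<^sup>2 * M2"
        using M2 y yb[OF y b] by (intro mult_mono) auto
      moreover have "\<bar>c \<bullet> b\<bar> * \<bar>g (inversion y)\<bar> \<le> (norm y)\<^sup>2 * M1"
        using M1 y N b c by (intro mult_mono) (auto simp: inner_Basis)
      moreover have "\<bar>partial_deriv c (\<lambda>y. partial_deriv b \<psi> (inversion y)) y\<bar> * 1 \<le> M3 * (norm y)\<^sup>2"
        using M3 y by (intro mult_mono) auto
      moreover have "\<bar>partial_deriv c (partial_deriv b \<phi>) y\<bar>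
          \<le> 2 * (\<bar>y \<bullet> b\<bar> * \<bar>partial_deriv c (\<lambda>y. g (inversion y)) y\<bar>) + 2 * (\<bar>c \<bullet> b\<bar> * \<bar>g (inversion y)\<bar>)
            + \<bar>partial_deriv c (\<lambda>y. partial_deriv b \<psi> (inversion y)) y\<bar>"
        using abs_triangle_ineq[of "2 * (y \<bullet> b) * partial_deriv c (\<lambda>y. g (inversion y)) y" "2 * (c \<bullet> b) * g (inversion y)"]
          abs_triangle_ineq[of "2 * (y \<bullet> b) * partial_deriv c (\<lambda>y. g (inversion y)) y + 2 * (c \<bullet> b) * g (inversion y)"]
        by (simp add: rep2[OF y0 b c] abs_mult mult.assoc)
          (smt (verit))
      ultimately show "\<bar>partial_deriv c (partial_deriv b \<phi>) y\<bar> \<le> (2 * M2 + 2 * M1 + M3) * (norm y)\<^sup>2"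
        by (simp add: algebra_simps)
    qed (use M1 M2 M3 in auto)
  qed
  show "\<exists>a>0. \<exists>C. \<forall>x. \<phi> x \<ge> a * (norm x)\<^sup>2 - C"
  proof -
    \<comment> \<open>By continuity \<open>\<psi>\<close> exceeds half its positive value at 0 near
      the origin. The inversion carries this to the quadratic lower bound for \<open>\<phi>\<close>
      outside the ball of radius 1 / d.\<close>
    obtain d where d: "d > 0" "\<And>z. dist z 0 < d \<Longrightarrow> dist (\<psi> z) (\<psi> 0) < \<psi> 0 / 2"
      using \<psi>c pos unfolding continuous_on_iff by (metis UNIV_I half_gt_zero)
    have far: "\<phi> y \<ge> \<psi> 0 / 2 * (norm y)\<^sup>2" if "norm y > inverse d" for y
    proof -
      have "norm y > 0" using that d(1) inverse_positive_iff_positive[of d] by linarith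
      moreover have "inverse (norm y) < d"
        using that d(1) calculation by (simp add: field_simps)
      then have "dist (\<psi> (inversion y)) (\<psi> 0) < \<psi> 0 / 2"
        by (intro d(2)) (simp add: norm_inversion)
      then have "\<psi> (inversion y) \<ge> \<psi> 0 / 2" unfolding dist_real_def by argo
      ultimately show ?thesis
        using mult_right_mono[of "\<psi> 0 / 2" "\<psi> (inversion y)" "(norm y)\<^sup>2"]
        by (simp add: rep power2_norm_eq_inner mult.commute)
    qed
    obtain B where B: "\<And>x. norm x \<le> inverse d \<Longrightarrow> \<bar>\<phi> x\<bar> \<le> B"
      using continuous_bounded_cball[OF \<phi>'(1)] by blast
    \<comment> \<open>The subtracted constant pays for the ball of radius 1 / d: its first summand
      cancels the quadratic term there and \<open>B\<close> bounds \<open>\<phi>\<close> from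
      below.\<close>
    have "\<phi> x \<ge> \<psi> 0 / 2 * (norm x)\<^sup>2 - (\<psi> 0 / 2 * (inverse d)\<^sup>2 + B)" for x
    proof (cases "norm x \<le> inverse d")
      case True
      then have "(norm x)\<^sup>2 \<le> (inverse d)\<^sup>2" by (intro power_mono) auto
      then have "\<psi> 0 / 2 * (norm x)\<^sup>2 \<le> \<psi> 0 / 2 * (inverse d)\<^sup>2" using pos by (intro mult_left_mono) auto
      with B[OF True] show ?thesis by linarith
    next
      case False
      have "0 \<le> B" using order_trans[OF abs_ge_zero B[of 0]] d(1) by simp
      moreover have "0 \<le> \<psi> 0 / 2 * (inverse d)\<^sup>2" using pos by simp
      ultimately show ?thesis using far[of x] False by linarith
    qed
    with pos show ?thesis by (intro exI[of _ "\<psi> 0 / 2"]) auto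
  qed
qed

section \<open>Divergence identities for the Newton tensor\<close>

lemma axis_1_in_Basis [simp]: "axis i (1::real) \<in> Basis"
  by (simp add: axis_in_Basis_iff)

abbreviation pd :: "'n \<Rightarrow> (real ^ 'n \<Rightarrow> real) \<Rightarrow> real ^ 'n \<Rightarrow> real" where
  "pd i \<equiv> partial_deriv (axis i 1)"

lemma smooth_on_pd: "smooth_on UNIV f \<Longrightarrow> smooth_on UNIV (pd i f)"
  by (rule smooth_onD(3)) simp_all

lemma smooth_on_component: "smooth_on S (\<lambda>x::real ^ 'n. x $ i)"
  by (rule smooth_on_bounded_linear) (rule bounded_linear_vec_nth)

lemma pd_component: "pd i (\<lambda>x. x $ j) x = (if i = j then 1 else 0)"
  by (subst partial_deriv_bounded_linear[OF bounded_linear_vec_nth]) (simp add: axis_def)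

lemma smooth_on_cdivide: "smooth_on UNIV f \<Longrightarrow> smooth_on UNIV (\<lambda>x. f x / c)"
  using smooth_on_mult[OF open_UNIV _ smooth_on_const[of _ "inverse c"], of f] by (simp add: divide_inverse)

lemma partial_deriv_cdivide:
  "f differentiable at x \<Longrightarrow> partial_deriv b (\<lambda>x. f x / c) x = partial_deriv b f x / c"
  using partial_deriv_mult[of f x "\<lambda>_. inverse c" b] by (simp add: divide_inverse)

lemmas smooth_UNIV_intros =
  smooth_on_const smooth_on_cdivide smooth_on_add[OF open_UNIV] smooth_on_diff[OF open_UNIV]
  smooth_on_mult[OF open_UNIV] smooth_on_sum[OF open_UNIV] smooth_on_component smooth_on_pd

lemmas smooth_differentiable = smooth_onD(1)[OF _ UNIV_I]

lemmas pd_simps =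
  partial_deriv_add[OF smooth_differentiable smooth_differentiable]
  partial_deriv_diff[OF smooth_differentiable smooth_differentiable]
  partial_deriv_mult[OF smooth_differentiable smooth_differentiable]
  partial_deriv_sum[OF smooth_differentiable]
  partial_deriv_cdivide[OF smooth_differentiable]

lemma pd_commute: "smooth_on UNIV f \<Longrightarrow> pd i (pd j f) x = pd j (pd i f) x"
  by (rule partial_deriv_commute) (simp_all add: smooth_on_def)

lemma smooth_on_exp_minus:
  assumes "smooth_on UNIV f"
  shows "smooth_on UNIV (\<lambda>x. exp (- f x))"
proof -
  have "((\<lambda>y. (-1) ^ i * exp (- y)) has_real_derivative (-1) ^ Suc i * exp (- f x)) (at (f x))"
    for i x by (auto intro!: derivative_eq_intros)
  from smooth_on_compose[OF open_UNIV, of "\<lambda>i y. (-1) ^ i * exp (- y)" f 0, OF this assms]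
  show ?thesis by simp
qed

lemma pd_exp_minus:
  assumes "smooth_on UNIV f"
  shows "pd i (\<lambda>x. exp (- f x)) x = - pd i f x * exp (- f x)"
  by (subst partial_deriv_real_compose[OF smooth_differentiable[OF assms], of "\<lambda>y. exp (- y)" "- exp (- f x)"])
    (auto intro!: derivative_eq_intros)

lemma smooth_C1: "smooth_on UNIV f \<Longrightarrow> C_k_on 1 UNIV f"
  by (simp only: smooth_on_def)

lemma integral_pd_eq_0:
  assumes "smooth_on UNIV F" "compact K" "\<And>x. x \<notin> K \<Longrightarrow> F x = 0"
  shows "integrable lborel (pd i F)" "(LINT x|lborel. pd i F x) = 0"
proof -
  obtain l u where lu: "K \<subseteq> cbox l u" using compact_subset_cbox[OF assms(2)] by blast
  have "pd i F x = 0" if "x \<notin> K" for x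
    by (rule partial_deriv_outside_support[OF compact_imp_closed[OF assms(2)] assms(3) that])
  with lu show "integrable lborel (pd i F)"
    by (intro integrable_compact_support[of _ l u] smooth_onD(2) smooth_on_pd assms(1)) auto
  show "(LINT x|lborel. pd i F x) = 0"
    by (rule integral_partial_deriv_eq_0[OF smooth_C1[OF assms(1)] _ assms(2,3)]) simp
qed

text \<open>Entries as separate scalar functions of the point, because \<open>partial_deriv\<close>
  acts on real-valued functions.\<close>

definition shifted_hessian :: "real \<Rightarrow> (real ^ 'n \<Rightarrow> real) \<Rightarrow> 'n \<Rightarrow> 'n \<Rightarrow> real ^ 'n \<Rightarrow> real" where
  "shifted_hessian lam \<phi> i j x = pd i (pd j \<phi>) x - (if i = j then lam else 0)"

lemma sigma1_eq:
  "sigma1 lam \<phi> x = (\<Sum>i\<in>UNIV. pd i (pd i \<phi>) x) - (1/2) * (\<Sum>i\<in>UNIV. pd i \<phi> x * pd i \<phi> x)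
     + lam * (\<phi> x - real CARD('n))" for \<phi> :: "real ^ 'n \<Rightarrow> real"
  unfolding sigma1_def laplacian_def trace_def hessian_def gradient_def
  by (simp add: power2_norm_eq_inner inner_vec_def algebra_simps)

lemma norm_matrix_power2: "(norm (B :: real ^ 'n ^ 'm))\<^sup>2 = (\<Sum>i\<in>UNIV. \<Sum>j\<in>UNIV. B $ i $ j * B $ i $ j)"
  by (simp add: power2_norm_eq_inner inner_vec_def)

lemma sigma2_eq:
  "sigma2 lam \<phi> x = (1/2) * ((sigma1 lam \<phi> x)\<^sup>2
     - (\<Sum>i\<in>UNIV. \<Sum>j\<in>UNIV. shifted_hessian lam \<phi> i j x * shifted_hessian lam \<phi> i j x))"
  unfolding sigma2_def norm_matrix_power2 shifted_hessian_def hessian_def mat_def by simp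

lemma smooth_on_shifted_hessian: "smooth_on UNIV \<phi> \<Longrightarrow> smooth_on UNIV (shifted_hessian lam \<phi> i j)"
  unfolding shifted_hessian_def[abs_def] by (intro smooth_UNIV_intros)

lemma smooth_on_sigma1: "smooth_on UNIV \<phi> \<Longrightarrow> smooth_on UNIV (sigma1 lam \<phi>)"
  unfolding sigma1_eq[abs_def] by (intro smooth_UNIV_intros)

lemma smooth_on_sigma2: "smooth_on UNIV \<phi> \<Longrightarrow> smooth_on UNIV (sigma2 lam \<phi>)"
  unfolding sigma2_eq[abs_def] power2_eq_square
  by (intro smooth_UNIV_intros smooth_on_sigma1 smooth_on_shifted_hessian)

lemma pd_shifted_hessian:
  "smooth_on UNIV \<phi> \<Longrightarrow> pd k (shifted_hessian lam \<phi> i j) x = pd k (pd i (pd j \<phi>)) x"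
  unfolding shifted_hessian_def[abs_def] by (simp add: pd_simps smooth_UNIV_intros)

lemma pd3_commute:
  assumes "smooth_on UNIV \<phi>"
  shows "pd i (pd j (pd k \<phi>)) x = pd j (pd i (pd k \<phi>)) x" "pd i (pd j (pd k \<phi>)) x = pd i (pd k (pd j \<phi>)) x"
proof -
  show "pd i (pd j (pd k \<phi>)) x = pd j (pd i (pd k \<phi>)) x"
    by (rule pd_commute) (intro smooth_UNIV_intros assms)
  have "pd j (pd k \<phi>) = pd k (pd j \<phi>)"
    by (rule ext) (rule pd_commute[OF assms])
  then show "pd i (pd j (pd k \<phi>)) x = pd i (pd k (pd j \<phi>)) x" by simp
qed

text \<open>In invariant terms, the weighted divergence of \<open>A\<close> is the gradient of
  \<open>sigma1\<close>. Differentiating - |grad \<phi>|^2 / 2 gives the Hessian applied to the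
  gradient, and \<open>lam * \<phi>\<close> completes it to the shifted Hessian.\<close>

lemma pd_sigma1:
  fixes \<phi> :: "real ^ 'n \<Rightarrow> real"
  assumes s: "smooth_on UNIV \<phi>"
  shows "pd j (sigma1 lam \<phi>) x = (\<Sum>i\<in>UNIV. pd i (pd i (pd j \<phi>)) x)
    - (\<Sum>i\<in>UNIV. shifted_hessian lam \<phi> i j x * pd i \<phi> x)"
proof -
  have "pd j (sigma1 lam \<phi>) x = (\<Sum>i\<in>UNIV. pd j (pd i (pd i \<phi>)) x)
      - (1/2) * (\<Sum>i\<in>UNIV. pd i \<phi> x * pd j (pd i \<phi>) x + pd j (pd i \<phi>) x * pd i \<phi> x) + lam * pd j \<phi> x"
    unfolding sigma1_eq[abs_def] by (simp add: pd_simps smooth_UNIV_intros s)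
  also have "(\<Sum>i\<in>UNIV. pd j (pd i (pd i \<phi>)) x) = (\<Sum>i\<in>UNIV. pd i (pd i (pd j \<phi>)) x)"
    using pd3_commute[OF s] by (intro sum.cong refl) metis
  also have "(1/2) * (\<Sum>i\<in>UNIV. pd i \<phi> x * pd j (pd i \<phi>) x + pd j (pd i \<phi>) x * pd i \<phi> x)
      = (\<Sum>i\<in>UNIV. pd i (pd j \<phi>) x * pd i \<phi> x)"
    by (simp add: sum_distrib_left pd_commute[OF s, of j] mult.commute)
  also have "lam * pd j \<phi> x = (\<Sum>i\<in>UNIV. (if i = j then lam else 0) * pd i \<phi> x)"
    by (simp add: if_distrib[of "\<lambda>a. a * _"] cong: if_cong)
  finally show ?thesis
    by (simp add: shifted_hessian_def left_diff_distrib sum_subtractf)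
qed

text \<open>The derivative of \<open>\<sigma>\<close> contributes the weighted divergence of
  \<open>A\<close> (\<open>pd_sigma1\<close>) and cancels against that of the subtracted tensor, so
  no third derivatives of \<open>\<phi>\<close> remain. What is left is the part of the linearised
  \<open>sigma2\<close> that contains derivatives of \<open>u\<close>, in divergence form.\<close>

lemma divergence_newton:
  fixes \<phi> u :: "real ^ 'n \<Rightarrow> real" and lam :: real
  assumes s: "smooth_on UNIV \<phi>" and u: "smooth_on UNIV u"
  defines "A \<equiv> shifted_hessian lam \<phi>" and "\<sigma> \<equiv> sigma1 lam \<phi>"
  shows "(\<Sum>i\<in>UNIV. pd i (\<lambda>x. exp (- \<phi> x) * (\<sigma> x * pd i u x - (\<Sum>j\<in>UNIV. A i j x * pd j u x))) x)
    = exp (- \<phi> x) * (\<sigma> x * ((\<Sum>i\<in>UNIV. pd i (pd i u) x) - (\<Sum>i\<in>UNIV. pd i \<phi> x * pd i u x))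
        - (\<Sum>i\<in>UNIV. \<Sum>j\<in>UNIV. A i j x * pd i (pd j u) x))"
proof -
  note sm = smooth_UNIV_intros s u smooth_on_exp_minus smooth_on_shifted_hessian smooth_on_sigma1
  define c where "c i j k = pd i (pd j (pd k \<phi>)) x" for i j k
  define a where "a i j = A i j x" for i j
  define p where "p i = pd i \<phi> x" for i
  define v where "v i = pd i u x" for i
  define h where "h i j = pd i (pd j u) x" for i j
  define e where "e = exp (- \<phi> x)"
  define t where "t j = (\<Sum>i\<in>UNIV. c i i j)" for j
  have dV: "pd i (\<lambda>x. exp (- \<phi> x) * (\<sigma> x * pd i u x - (\<Sum>j\<in>UNIV. A i j x * pd j u x))) x
    = e * ((t i - (\<Sum>k\<in>UNIV. a k i * p k)) * v i + \<sigma> x * h i i - (\<Sum>j\<in>UNIV. c i i j * v j)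
         - (\<Sum>j\<in>UNIV. a i j * h i j) - p i * \<sigma> x * v i + p i * (\<Sum>j\<in>UNIV. a i j * v j))" for i
    unfolding A_def \<sigma>_def
    by (simp add: pd_simps sm pd_exp_minus pd_shifted_hessian pd_sigma1)
      (simp add: c_def a_def p_def v_def h_def e_def t_def A_def \<sigma>_def sum.distrib algebra_simps)
  have "(\<Sum>i\<in>UNIV. pd i (\<lambda>x. exp (- \<phi> x) * (\<sigma> x * pd i u x - (\<Sum>j\<in>UNIV. A i j x * pd j u x))) x)
    = e * ((\<Sum>i\<in>UNIV. t i * v i) - (\<Sum>i\<in>UNIV. \<Sum>k\<in>UNIV. a k i * p k * v i) + \<sigma> x * (\<Sum>i\<in>UNIV. h i i)
        - (\<Sum>i\<in>UNIV. \<Sum>j\<in>UNIV. c i i j * v j)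
        - (\<Sum>i\<in>UNIV. \<Sum>j\<in>UNIV. a i j * h i j) - \<sigma> x * (\<Sum>i\<in>UNIV. p i * v i)
        + (\<Sum>i\<in>UNIV. \<Sum>j\<in>UNIV. a i j * p i * v j))"
    unfolding dV
    by (simp add: sum_distrib_left sum_distrib_right sum.distrib sum_subtractf algebra_simps)
  also have "(\<Sum>i\<in>UNIV. \<Sum>j\<in>UNIV. c i i j * v j) = (\<Sum>i\<in>UNIV. t i * v i)"
    by (subst sum.swap) (simp add: t_def sum_distrib_right)
  also have "(\<Sum>i\<in>UNIV. \<Sum>j\<in>UNIV. a i j * p i * v j) = (\<Sum>i\<in>UNIV. \<Sum>k\<in>UNIV. a k i * p k * v i)"
    by (rule sum.swap)
  finally show ?thesis
    by (simp add: e_def p_def v_def h_def a_def algebra_simps)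
qed

text \<open>The tensor \<open>T A\<close>, where \<open>T = s I - A\<close> is the Newton tensor of the shifted problem.\<close>

definition newton_hessian :: "real \<Rightarrow> (real ^ 'n \<Rightarrow> real) \<Rightarrow> 'n \<Rightarrow> 'n \<Rightarrow> real ^ 'n \<Rightarrow> real" where
  "newton_hessian lam \<phi> i j x = (sigma1 lam \<phi> x - lam) * shifted_hessian lam \<phi> i j x
     - (\<Sum>k\<in>UNIV. shifted_hessian lam \<phi> i k x * shifted_hessian lam \<phi> k j x)"

lemma smooth_on_newton_hessian: "smooth_on UNIV \<phi> \<Longrightarrow> smooth_on UNIV (newton_hessian lam \<phi> i j)"
  unfolding newton_hessian_def[abs_def]
  by (intro smooth_UNIV_intros smooth_on_sigma1 smooth_on_shifted_hessian)

text \<open>Up to the constant \<open>lam\<^sup>2 / 2\<close>, \<open>sigma2 lam \<phi> - lam * sigma1 lam \<phi>\<close> is half of \<open>s\<^sup>2 - |A|\<^sup>2\<close>.\<close>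

lemma divergence_newton_hessian:
  fixes \<phi> :: "real ^ 'n \<Rightarrow> real"
  assumes s: "smooth_on UNIV \<phi>"
  shows "(\<Sum>i\<in>UNIV. pd i (newton_hessian lam \<phi> i j) x - pd i \<phi> x * newton_hessian lam \<phi> i j x)
    = pd j (\<lambda>x. sigma2 lam \<phi> x - lam * sigma1 lam \<phi> x) x"
proof -
  note sm = smooth_UNIV_intros s smooth_on_shifted_hessian smooth_on_sigma1 smooth_on_sigma2
  define c where "c i j k = pd i (pd j (pd k \<phi>)) x" for i j k
  define a where "a i j = shifted_hessian lam \<phi> i j x" for i j
  define p where "p i = pd i \<phi> x" for i
  define \<sigma> where "\<sigma> = sigma1 lam \<phi> x - lam"
  define t where "t j = (\<Sum>i\<in>UNIV. c i i j)" for j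
  define d where "d j = t j - (\<Sum>k\<in>UNIV. a k j * p k)" for j
  \<comment> \<open>The Codazzi symmetry of the Hessian: it turns the contraction of
    \<open>A\<close> with its own derivatives into half the gradient of |A|^2.\<close>
  have c_sym: "c i k j = c j i k" for i j k
    unfolding c_def using pd3_commute[OF s] by metis
  have ds: "pd i (sigma1 lam \<phi>) x = d i" for i
    by (simp add: pd_sigma1[OF s] d_def t_def c_def a_def p_def)
  have dB: "pd i (newton_hessian lam \<phi> i j) x = d i * a i j + \<sigma> * c i i j
      - (\<Sum>k\<in>UNIV. c i i k * a k j) - (\<Sum>k\<in>UNIV. a i k * c i k j)" for i
    unfolding newton_hessian_def[abs_def]
    by (simp add: pd_simps sm pd_shifted_hessian ds)
      (simp add: c_def a_def \<sigma>_def sum.distrib algebra_simps)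
  have B: "newton_hessian lam \<phi> i j x = \<sigma> * a i j - (\<Sum>k\<in>UNIV. a i k * a k j)" for i
    by (simp add: newton_hessian_def a_def \<sigma>_def)
  have "(\<Sum>i\<in>UNIV. pd i (newton_hessian lam \<phi> i j) x - pd i \<phi> x * newton_hessian lam \<phi> i j x)
    = (\<Sum>i\<in>UNIV. d i * a i j) + \<sigma> * t j - (\<Sum>i\<in>UNIV. \<Sum>k\<in>UNIV. c i i k * a k j)
      - (\<Sum>i\<in>UNIV. \<Sum>k\<in>UNIV. a i k * c i k j) - \<sigma> * (\<Sum>i\<in>UNIV. a i j * p i)
      + (\<Sum>i\<in>UNIV. \<Sum>k\<in>UNIV. a i k * p i * a k j)"
    unfolding dB B p_def[symmetric] t_def
    by (simp add: sum_distrib_left sum_distrib_right sum.distrib sum_subtractf algebra_simps)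
  also have "(\<Sum>i\<in>UNIV. \<Sum>k\<in>UNIV. c i i k * a k j) = (\<Sum>k\<in>UNIV. t k * a k j)"
    by (subst sum.swap) (simp add: t_def sum_distrib_right)
  also have "(\<Sum>i\<in>UNIV. \<Sum>k\<in>UNIV. a i k * p i * a k j) = (\<Sum>k\<in>UNIV. (\<Sum>i\<in>UNIV. a i k * p i) * a k j)"
    by (subst sum.swap) (simp add: sum_distrib_right)
  \<comment> \<open>The gradient of s hitting s A cancels against the weighted divergence of the
    left factor of A A.\<close>
  also have "(\<Sum>i\<in>UNIV. d i * a i j)
      = (\<Sum>k\<in>UNIV. t k * a k j) - (\<Sum>k\<in>UNIV. (\<Sum>i\<in>UNIV. a i k * p i) * a k j)"
    by (simp add: d_def left_diff_distrib sum_subtractf)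
  also have "\<sigma> * t j = \<sigma> * d j + \<sigma> * (\<Sum>i\<in>UNIV. a i j * p i)"
    by (simp add: d_def algebra_simps)
  finally have L: "(\<Sum>i\<in>UNIV. pd i (newton_hessian lam \<phi> i j) x - pd i \<phi> x * newton_hessian lam \<phi> i j x)
      = \<sigma> * d j - (\<Sum>i\<in>UNIV. \<Sum>k\<in>UNIV. a i k * c j i k)"
    by (simp add: c_sym[of _ _ j])
  have "pd j (\<lambda>x. sigma2 lam \<phi> x - lam * sigma1 lam \<phi> x) x
      = (1/2) * (2 * (sigma1 lam \<phi> x * d j) - (\<Sum>i\<in>UNIV. \<Sum>k\<in>UNIV. a i k * c j i k + c j i k * a i k))
        - lam * d j"
    unfolding sigma2_eq[abs_def] power2_eq_square
    by (simp add: pd_simps sm pd_shifted_hessian ds a_def c_def)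
  also have "\<dots> = \<sigma> * d j - (\<Sum>i\<in>UNIV. \<Sum>k\<in>UNIV. a i k * c j i k)"
    by (simp add: \<sigma>_def sum.distrib sum_distrib_left algebra_simps)
  finally show ?thesis using L by simp
qed

section \<open>The Euler-Lagrange equation\<close>

lemma smooth_on_ln:
  assumes "open S" "smooth_on S f" "\<And>x. x \<in> S \<Longrightarrow> f x > 0"
  shows "smooth_on S (\<lambda>x. ln (f x))"
proof -
  \<comment> \<open>The successive derivatives of \<open>ln\<close>: the one of order j + 1 is
    (-1)^j j! / y^(j+1).\<close>
  define G :: "nat \<Rightarrow> real \<Rightarrow> real" where
    "G i = (case i of 0 \<Rightarrow> ln | Suc j \<Rightarrow> (\<lambda>y. (-1) ^ j * fact j * inverse y ^ Suc j))" for i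
  have "(G i has_real_derivative G (Suc i) y) (at y)" if "y > 0" for i y
  proof (cases i)
    case 0
    then show ?thesis
      using that by (auto simp: G_def inverse_eq_divide intro!: derivative_eq_intros)
  next
    case (Suc j)
    have "((\<lambda>y. (-1) ^ j * fact j * inverse y ^ Suc j) has_real_derivative
        (-1) ^ j * fact j * (real (Suc j) * inverse y ^ j * - (inverse y ^ 2))) (at y)"
      by (intro DERIV_cmult DERIV_cong[OF DERIV_power[OF DERIV_inverse]]) (use that in \<open>simp_all add: power2_eq_square\<close>)
    then show ?thesis using Suc by (simp add: G_def mult_ac power2_eq_square algebra_simps)
  qed
  from smooth_on_compose[OF assms(1), of G f 0, OF this assms(2)] assms(3)
  show ?thesis by (simp add: G_def)
qed

lemma weight_pos: "\<tau> > 0 \<Longrightarrow> weight \<phi> \<tau> x > 0"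
  by (simp add: weight_def)

lemma smooth_on_weight: "smooth_on UNIV \<phi> \<Longrightarrow> smooth_on UNIV (weight \<phi> \<tau>)"
  unfolding weight_def[abs_def] by (intro smooth_UNIV_intros smooth_on_exp_minus)

lemma C1_space_integrable_weight: "(\<phi>, \<tau>) \<in> C1_space \<Longrightarrow> integrable lborel (weight \<phi> \<tau>)"
  using not_integrable_integral_eq by (fastforce simp: C1_space_def)

lemma bounded_compact_support:
  fixes u :: "'a::euclidean_space \<Rightarrow> real"
  assumes "continuous_on UNIV u" "compact K" "\<And>x. x \<notin> K \<Longrightarrow> u x = 0"
  obtains M where "M > 0" "\<And>x. \<bar>u x\<bar> \<le> M"
proof -
  have "bounded (u ` K)"
    using assms(1,2) by (intro compact_imp_bounded compact_continuous_image)
      (auto intro: continuous_on_subset)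
  then obtain B where B: "B > 0" "\<forall>y\<in>u ` K. norm y \<le> B" unfolding bounded_pos by blast
  have "\<bar>u x\<bar> \<le> B" for x
    using B assms(3)[of x] by (cases "x \<in> K") auto
  with B(1) that show ?thesis by blast
qed

text \<open>With \<rho> = 1 + t u, the gradient of ln \<rho> is t / \<rho> times the gradient of
  \<open>u\<close>, and the gradient of t / \<rho> is - (t / \<rho>)^2 times it. Both formulas for
  derivatives thus depend on t only through t / \<rho>.\<close>

lemma
  fixes \<phi> u :: "real ^ 'n \<Rightarrow> real"
  assumes s: "smooth_on UNIV \<phi>" and u: "smooth_on UNIV u" and pos: "\<And>x. 1 + t * u x > 0"
  shows smooth_on_minus_ln: "smooth_on UNIV (\<lambda>x. \<phi> x - ln (1 + t * u x))"
    and pd_minus_ln: "pd j (\<lambda>x. \<phi> x - ln (1 + t * u x)) x = pd j \<phi> x - t / (1 + t * u x) * pd j u x"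
    and pd_pd_minus_ln: "pd i (pd j (\<lambda>x. \<phi> x - ln (1 + t * u x))) x
      = pd i (pd j \<phi>) x - t / (1 + t * u x) * pd i (pd j u) x
        + (t / (1 + t * u x))\<^sup>2 * (pd i u x * pd j u x)"
proof -
  note sm = smooth_UNIV_intros s u
  have \<rho>: "smooth_on UNIV (\<lambda>x. 1 + t * u x)" by (intro sm)
  note \<rho>d = smooth_differentiable[OF \<rho>]
  have \<rho>': "pd j (\<lambda>x. 1 + t * u x) x = t * pd j u x" for j x
    by (simp add: pd_simps sm)
  have ln: "smooth_on UNIV (\<lambda>x. ln (1 + t * u x))"
    by (rule smooth_on_ln[OF open_UNIV \<rho>]) (rule pos)
  have ln': "pd j (\<lambda>x. ln (1 + t * u x)) x = t / (1 + t * u x) * pd j u x" for j x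
    using partial_deriv_real_compose[OF \<rho>d DERIV_ln[OF pos[of x]], of "axis j 1"]
    by (simp add: \<rho>' divide_inverse)
  show "smooth_on UNIV (\<lambda>x. \<phi> x - ln (1 + t * u x))" by (intro sm ln)
  have 1: "pd j (\<lambda>x. \<phi> x - ln (1 + t * u x)) x = pd j \<phi> x - t / (1 + t * u x) * pd j u x" for j x
    by (simp add: pd_simps sm ln ln')
  show "pd j (\<lambda>x. \<phi> x - ln (1 + t * u x)) x = pd j \<phi> x - t / (1 + t * u x) * pd j u x"
    by (rule 1)
  have q: "((\<lambda>y. t / y) has_real_derivative - t / (1 + t * u x)\<^sup>2) (at (1 + t * u x))" for x
    using pos[of x] by (auto intro!: derivative_eq_intros simp: power2_eq_square)
  have r: "(\<lambda>x. t / (1 + t * u x)) differentiable at x"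
    "pd i (\<lambda>x. t / (1 + t * u x)) x = - (t / (1 + t * u x))\<^sup>2 * pd i u x" for i x
    using differentiableI[OF has_derivative_real_compose[OF \<rho>d q]]
      partial_deriv_real_compose[OF \<rho>d q[of x], of "axis i 1"]
    by (simp_all add: \<rho>' power2_eq_square)
  have d\<phi>: "pd j \<phi> differentiable at x" and du: "pd j u differentiable at x"
    by (intro smooth_differentiable sm)+
  have "pd i (pd j (\<lambda>x. \<phi> x - ln (1 + t * u x))) x
      = pd i (\<lambda>x. pd j \<phi> x - t / (1 + t * u x) * pd j u x) x"
    by (subst ext[OF 1]) (rule refl)
  also have "\<dots> = pd i (pd j \<phi>) x - (t / (1 + t * u x) * pd i (pd j u) x
      + (- (t / (1 + t * u x))\<^sup>2 * pd i u x) * pd j u x)"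
    unfolding partial_deriv_diff[OF d\<phi> differentiable_mult[OF r(1) du]] partial_deriv_mult[OF r(1) du] r(2)
    by (rule refl)
  finally show "pd i (pd j (\<lambda>x. \<phi> x - ln (1 + t * u x))) x
      = pd i (pd j \<phi>) x - t / (1 + t * u x) * pd i (pd j u) x
        + (t / (1 + t * u x))\<^sup>2 * (pd i u x * pd j u x)"
    by simp
qed

lemma weight_minus_ln:
  "1 + t * u x > 0 \<Longrightarrow> weight (\<lambda>x. \<phi> x - ln (1 + t * u x)) \<tau> x = weight \<phi> \<tau> x * (1 + t * u x)"
  by (simp add: weight_def exp_diff exp_minus field_simps)

lemma smooth_on_minus_ln_joint:
  fixes \<phi> u :: "'a::euclidean_space \<Rightarrow> real"
  assumes s: "smooth_on UNIV \<phi>" and u: "smooth_on UNIV u" and U: "open U"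
    and pos: "\<And>t x. t \<in> U \<Longrightarrow> 1 + t * u x > 0"
  shows "smooth_on (U \<times> UNIV) (\<lambda>(t, x). \<phi> x - ln (1 + t * u x))"
proof -
  have o: "open (U \<times> (UNIV :: 'a set))" using U by (intro open_Times) auto
  have snd: "smooth_on (U \<times> UNIV) (\<lambda>p. f (snd p))" if "smooth_on UNIV f" for f :: "'a \<Rightarrow> real"
    using that C_k_on_subset[OF C_k_on_snd] by (auto simp: smooth_on_def)
  have "smooth_on (U \<times> UNIV) (\<lambda>p. \<phi> (snd p) - ln (1 + fst p * u (snd p)))"
    by (intro smooth_on_diff smooth_on_ln smooth_on_add smooth_on_mult smooth_on_const o snd s u
        smooth_on_bounded_linear bounded_linear_fst) (use pos in auto)
  then show ?thesis by (simp add: case_prod_unfold)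
qed

text \<open>For a variation with \<open>exp (- \<Phi> t) = (1 + t u) exp (- \<phi>)\<close> the normalisation is affine in \<open>t\<close>,
  so no correction term is needed to stay in the constraint set.\<close>

lemma admissible_curve_minus_ln:
  fixes \<phi> u :: "real ^ 'n \<Rightarrow> real"
  assumes C: "(\<phi>, \<tau>) \<in> C1_space" and u: "smooth_on UNIV u"
    and K: "compact K" "\<And>x. x \<notin> K \<Longrightarrow> u x = 0"
    and constraint: "(LINT x|lborel. u x * weight \<phi> \<tau> x) = 0"
    and e: "e > 0" and pos: "\<And>t x. t \<in> {-e<..<e} \<Longrightarrow> 1 + t * u x > 0"
  shows "admissible_curve \<phi> \<tau> e (\<lambda>t x. \<phi> x - ln (1 + t * u x)) (\<lambda>t. \<tau>)"
proof -
  have s: "smooth_on UNIV \<phi>" and \<tau>: "\<tau> > 0" and one: "(LINT x|lborel. weight \<phi> \<tau> x) = 1"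
    using C by (auto simp: C1_space_def)
  have wc: "continuous_on UNIV (weight \<phi> \<tau>)"
    by (rule smooth_onD(2)[OF smooth_on_weight[OF s]])
  have uc: "continuous_on UNIV u" by (rule smooth_onD(2)[OF u])
  obtain l r where "K \<subseteq> cbox l r" using compact_subset_cbox[OF K(1)] by blast
  then have uw: "integrable lborel (\<lambda>x. u x * weight \<phi> \<tau> x)"
    using K(2) by (intro integrable_compact_support[of _ l r] continuous_on_mult uc wc) auto
  have "(LINT x|lborel. weight (\<lambda>x. \<phi> x - ln (1 + t * u x)) \<tau> x) = 1" if "t \<in> {-e<..<e}" for t
  proof -
    \<comment> \<open>The new mass is 1 + t times the integral of \<open>u\<close> against the
      weight, and the latter vanishes by \<open>constraint\<close>.\<close>
    have "(LINT x|lborel. weight (\<lambda>x. \<phi> x - ln (1 + t * u x)) \<tau> x)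
        = (LINT x|lborel. weight \<phi> \<tau> x + t * (u x * weight \<phi> \<tau> x))"
      using pos[OF that] by (simp add: weight_minus_ln algebra_simps)
    also have "\<dots> = 1"
      using C1_space_integrable_weight[OF C] uw by (simp add: one constraint)
    finally show ?thesis .
  qed
  with \<tau> have "\<forall>t\<in>{-e<..<e}. (\<lambda>x. \<phi> x - ln (1 + t * u x), \<tau>) \<in> C1_space"
    using smooth_on_minus_ln[OF s u pos] by (auto simp: C1_space_def)
  moreover have "smooth_on ({-e<..<e} \<times> UNIV) (\<lambda>(t, x). \<phi> x - ln (1 + t * u x))"
    by (rule smooth_on_minus_ln_joint[OF s u _ pos]) auto
  moreover have "\<exists>K. compact K \<and> (\<forall>t\<in>{-e<..<e}. \<forall>x. x \<notin> K \<longrightarrow> \<phi> x - ln (1 + t * u x) - \<phi> x = 0)"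
    using K by (intro exI[of _ K]) auto
  ultimately show ?thesis
    using e unfolding admissible_curve_def by (auto intro: smooth_on_const)
qed

text \<open>To first order \<open>\<phi>\<close> moves by - u. The weight then contributes
  \<open>sigma2\<close> times \<open>u\<close>, the undifferentiated \<open>\<phi>\<close> in
  \<open>sigma1\<close> contributes - lam \<open>sigma1\<close> times \<open>u\<close>, and the
  terms with derivatives of \<open>u\<close> form a divergence, which integrates to 0 by
  \<open>divergence_newton\<close>.\<close>

lemma first_variation:
  fixes \<phi> u :: "real ^ 'n \<Rightarrow> real"
  assumes C: "(\<phi>, \<tau>) \<in> C1_space" and crit: "W2_critical \<phi> \<tau>"
    and lam: "lam = 1 / (2 * \<tau>)"
    and int: "integrable lborel (\<lambda>x. sigma2 lam \<phi> x * weight \<phi> \<tau> x)"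
    and u: "smooth_on UNIV u"
    and K: "compact K" "\<And>x. x \<notin> K \<Longrightarrow> u x = 0"
    and constraint: "(LINT x|lborel. u x * weight \<phi> \<tau> x) = 0"
  shows "(LINT x|lborel. (sigma2 lam \<phi> x - lam * sigma1 lam \<phi> x) * u x * weight \<phi> \<tau> x) = 0"
proof -
  have s: "smooth_on UNIV \<phi>" and \<tau>: "\<tau> > 0"
    using C by (auto simp: C1_space_def)
  define w where "w = weight \<phi> \<tau>"
  have uc: "continuous_on UNIV u" by (rule smooth_onD(2)[OF u])
  obtain M where M: "M > 0" "\<And>x. \<bar>u x\<bar> \<le> M"
    using bounded_compact_support[OF uc K] by blast
  \<comment> \<open>For |t| < 1 / M the product t u stays strictly above -1, so the logarithm is
    defined everywhere.\<close>
  define e where "e = 1 / M"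
  define U where "U = {-e<..<e}"
  have e: "e > 0" using M(1) by (simp add: e_def)
  have U: "0 \<in> U" "open U" "convex U" using e by (auto simp: U_def)
  define \<rho> where "\<rho> t x = 1 + t * u x" for t x
  have pos: "\<rho> t x > 0" if "t \<in> U" for t x
  proof -
    have "\<bar>t * u x\<bar> \<le> \<bar>t\<bar> * M" using M(2)[of x] by (simp add: abs_mult mult_left_mono)
    also have "\<dots> < e * M" using that M(1) by (intro mult_strict_right_mono) (auto simp: U_def)
    finally show ?thesis using M(1) by (simp add: e_def \<rho>_def abs_less_iff)
  qed
  define \<Phi> where "\<Phi> t = (\<lambda>x. \<phi> x - ln (\<rho> t x))" for t
  have "admissible_curve \<phi> \<tau> e \<Phi> (\<lambda>t. \<tau>)"
    unfolding \<Phi>_def[abs_def] \<rho>_def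
    by (rule admissible_curve_minus_ln[OF C u K constraint e])
      (use pos in \<open>auto simp: U_def \<rho>_def\<close>)
  then have W2': "((\<lambda>t. W2 (\<Phi> t) \<tau>) has_real_derivative 0) (at 0)"
    using crit unfolding W2_critical_def by blast

  define p where "p i = pd i \<phi>" for i
  define v where "v i = pd i u" for i
  define h where "h i j = pd i (pd j u)" for i j
  define a where "a i j = shifted_hessian lam \<phi> i j" for i j
  define \<sigma> where "\<sigma> = sigma1 lam \<phi>"
  \<comment> \<open>\<open>P\<close> is the weighted Laplacian of \<open>u\<close>. Along the curve,
    \<open>S\<close> is \<open>sigma1\<close>, \<open>H\<close> the shifted Hessian,
    \<open>N\<close> its squared norm and \<open>I\<close> the integrand without the factor
    \<tau>^2; primed names are derivatives in t.\<close>
  define P where "P x = (\<Sum>i\<in>UNIV. h i i x) - (\<Sum>i\<in>UNIV. p i x * v i x)" for x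
  define Q where "Q x = (\<Sum>i\<in>UNIV. v i x * v i x)" for x
  define r where "r t x = t / \<rho> t x" for t x
  define r' where "r' t x = 1 / (\<rho> t x)\<^sup>2" for t x
  define S where "S t x = \<sigma> x - r t x * P x + (r t x)\<^sup>2 * Q x / 2 - lam * ln (\<rho> t x)" for t x
  define S' where "S' t x = - (r' t x * P x) + r t x * r' t x * Q x - lam * (u x / \<rho> t x)" for t x
  define H where "H t i j x = a i j x - r t x * h i j x + (r t x)\<^sup>2 * (v i x * v j x)" for t i j x
  define H' where "H' t i j x = - (r' t x * h i j x) + 2 * r t x * r' t x * (v i x * v j x)" for t i j x
  define N where "N t x = (\<Sum>i\<in>UNIV. \<Sum>j\<in>UNIV. H t i j x * H t i j x)" for t x
  define N' where "N' t x = (\<Sum>i\<in>UNIV. \<Sum>j\<in>UNIV. 2 * (H t i j x * H' t i j x))" for t x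
  define I where "I t x = (1/2) * ((S t x)\<^sup>2 - N t x) * (\<rho> t x * w x)" for t x
  define I' where "I' t x = (S t x * S' t x - N' t x / 2) * (\<rho> t x * w x)
      + (1/2) * ((S t x)\<^sup>2 - N t x) * (u x * w x)" for t x

  have cont: "continuous_on UNIV (p i)" "continuous_on UNIV (v i)" "continuous_on UNIV (h i j)"
    "continuous_on UNIV (a i j)" "continuous_on UNIV \<sigma>" "continuous_on UNIV w"
    "continuous_on UNIV \<phi>" for i j
    unfolding p_def v_def h_def a_def \<sigma>_def w_def
    by (intro smooth_onD(2)[of UNIV] smooth_UNIV_intros smooth_on_shifted_hessian smooth_on_sigma1
        smooth_on_weight s u)+
  note [continuous_intros] = continuous_on_compose2[OF uc _ subset_UNIV]
    cont[THEN continuous_on_compose2, OF _ subset_UNIV]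
  have contP: "continuous_on UNIV P" "continuous_on UNIV Q"
    unfolding P_def[abs_def] Q_def[abs_def] by (intro continuous_intros)+
  note [continuous_intros] = contP[THEN continuous_on_compose2, OF _ subset_UNIV]
  have \<rho>0: "\<rho> (fst z) (snd z) \<noteq> 0" if "z \<in> U \<times> UNIV" for z
    using pos[of "fst z" "snd z"] that by auto
  have cont\<rho>: "continuous_on (U \<times> UNIV) (\<lambda>z. \<rho> (fst z) (snd z))"
    unfolding \<rho>_def by (intro continuous_intros)
  have contr: "continuous_on (U \<times> UNIV) (\<lambda>z. r (fst z) (snd z))"
    "continuous_on (U \<times> UNIV) (\<lambda>z. r' (fst z) (snd z))"
    "continuous_on (U \<times> UNIV) (\<lambda>z. ln (\<rho> (fst z) (snd z)))"
    "continuous_on (U \<times> UNIV) (\<lambda>z. u (snd z) / \<rho> (fst z) (snd z))"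
    unfolding r_def r'_def
    by (intro continuous_intros cont\<rho>; use \<rho>0 in force)+
  have contS: "continuous_on (U \<times> UNIV) (\<lambda>z. S (fst z) (snd z))"
    "continuous_on (U \<times> UNIV) (\<lambda>z. S' (fst z) (snd z))"
    "continuous_on (U \<times> UNIV) (\<lambda>z. N (fst z) (snd z))"
    "continuous_on (U \<times> UNIV) (\<lambda>z. N' (fst z) (snd z))"
    unfolding S_def S'_def N_def N'_def H_def H'_def
    by (intro continuous_intros contr; simp)+
  have contI: "continuous_on (U \<times> UNIV) (\<lambda>z. I (fst z) (snd z))"
    "continuous_on (U \<times> UNIV) (\<lambda>z. I' (fst z) (snd z))"
    unfolding I_def I'_def by (intro continuous_intros contS cont\<rho>; simp)+
  have contIt: "continuous_on UNIV (I t)" "continuous_on UNIV (I' t)" if "t \<in> U" for t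
  proof -
    have "continuous_on UNIV (\<lambda>x. (t, x))" "range (\<lambda>x. (t, x)) \<subseteq> U \<times> UNIV"
      using that by (auto intro!: continuous_intros)
    from contI[THEN continuous_on_compose2, OF this]
    show "continuous_on UNIV (I t)" "continuous_on UNIV (I' t)" by simp_all
  qed

  have derI: "((\<lambda>t. I t x) has_real_derivative I' t x) (at t)" if t: "t \<in> U" for t x
  proof -
    note \<rho>t = pos[OF t, of x]
    have d\<rho>: "((\<lambda>t. \<rho> t x) has_real_derivative u x) (at t)"
      unfolding \<rho>_def by (auto intro!: derivative_eq_intros)
    have dr: "((\<lambda>t. r t x) has_real_derivative r' t x) (at t)"
      unfolding r_def r'_def
      by (rule DERIV_cong[OF DERIV_divide[OF DERIV_ident d\<rho>]])
        (use \<rho>t in \<open>auto simp: \<rho>_def power2_eq_square\<close>)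
    have dl: "((\<lambda>t. ln (\<rho> t x)) has_real_derivative u x / \<rho> t x) (at t)"
      by (rule DERIV_cong[OF DERIV_chain2[OF DERIV_ln[OF \<rho>t] d\<rho>]]) (simp add: divide_inverse)
    have dr2: "((\<lambda>t. (r t x)\<^sup>2) has_real_derivative 2 * r t x * r' t x) (at t)"
      by (rule DERIV_cong[OF DERIV_power[OF dr]]) simp
    have dS: "((\<lambda>t. S t x) has_real_derivative S' t x) (at t)"
      unfolding S_def S'_def
      by (rule DERIV_cong[OF DERIV_diff[OF DERIV_add[OF DERIV_diff[OF DERIV_const
            DERIV_cmult_right[OF dr]] DERIV_cdivide[OF DERIV_cmult_right[OF dr2]]] DERIV_cmult[OF dl]]])
        simp
    have dH: "((\<lambda>t. H t i j x) has_real_derivative H' t i j x) (at t)" for i j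
      unfolding H_def H'_def
      by (rule DERIV_cong[OF DERIV_add[OF DERIV_diff[OF DERIV_const DERIV_cmult_right[OF dr]]
            DERIV_cmult_right[OF dr2]]]) simp
    have dN: "((\<lambda>t. N t x) has_real_derivative N' t x) (at t)"
      unfolding N_def N'_def
      by (intro DERIV_sum) (rule DERIV_cong[OF DERIV_mult[OF dH dH]], simp)
    show ?thesis
      unfolding I_def I'_def
      by (rule DERIV_cong[OF DERIV_mult[OF DERIV_cmult[OF DERIV_diff[OF DERIV_power[OF dS] dN]]
            DERIV_cmult_right[OF d\<rho>]]]) (simp add: algebra_simps)
  qed

  have I_eq: "sigma2 lam (\<Phi> t) x * weight (\<Phi> t) \<tau> x = I t x" if t: "t \<in> U" for t x
  proof -
    note pos' = pos[OF t, unfolded \<rho>_def]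
    have 1: "pd j (\<Phi> t) x = p j x - r t x * v j x" for j
      unfolding \<Phi>_def \<rho>_def pd_minus_ln[OF s u pos'] by (simp add: p_def v_def r_def \<rho>_def)
    have 2: "pd i (pd j (\<Phi> t)) x = pd i (pd j \<phi>) x - r t x * h i j x + (r t x)\<^sup>2 * (v i x * v j x)" for i j
      unfolding \<Phi>_def \<rho>_def pd_pd_minus_ln[OF s u pos'] by (simp add: h_def v_def r_def \<rho>_def)
    have "sigma1 lam (\<Phi> t) x = S t x"
      unfolding sigma1_eq 1 2 S_def \<sigma>_def P_def Q_def
      by (simp add: \<Phi>_def p_def[symmetric] sum.distrib sum_subtractf sum_distrib_left
          sum_divide_distrib[symmetric] power2_eq_square algebra_simps)
    moreover have "shifted_hessian lam (\<Phi> t) i j x = H t i j x" for i j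
      unfolding shifted_hessian_def 2 H_def a_def by simp
    moreover have "weight (\<Phi> t) \<tau> x = \<rho> t x * w x"
      unfolding \<Phi>_def \<rho>_def w_def using weight_minus_ln[OF pos'] by (simp add: mult.commute)
    ultimately show ?thesis by (simp add: sigma2_eq I_def N_def)
  qed
  have I0: "I 0 x = sigma2 lam \<phi> x * w x" for x
    using I_eq[OF U(1), of x] by (simp add: \<Phi>_def \<rho>_def w_def)
  have intI0: "integrable lborel (I 0)" using int by (simp add: I0[abs_def] w_def)

  have out: "u x = 0" "v i x = 0" "h i j x = 0" if "x \<notin> K" for x i j
  proof -
    have v0: "pd j u x = 0" if "x \<notin> K" for j x
      by (rule partial_deriv_outside_support[OF compact_imp_closed[OF K(1)] K(2) that])
    show "u x = 0" "v i x = 0" using K(2) v0 that by (auto simp: v_def)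
    show "h i j x = 0"
      unfolding h_def by (rule partial_deriv_outside_support[OF compact_imp_closed[OF K(1)] v0 that])
  qed
  \<comment> \<open>The integrand need not vanish outside \<open>K\<close>, but it is independent of
    t there.\<close>
  have I_out: "I t x = I 0 x" "I' t x = 0" if "x \<notin> K" for t x
    by (simp_all add: I_def I'_def S_def S'_def N_def N'_def H_def H'_def P_def Q_def \<rho>_def
        out[OF that])
  obtain l b where lb: "K \<subseteq> cbox l b" using compact_subset_cbox[OF K(1)] by blast

  \<comment> \<open>Integrability of \<open>I 0\<close> allows splitting off the part constant in t,
    which leaves a difference supported in a fixed box for the Leibniz rule.\<close>
  have W2_eq: "W2 (\<Phi> t) \<tau> = \<tau>\<^sup>2 * (integral (cbox l b) (\<lambda>x. I t x - I 0 x) + (LINT x|lborel. I 0 x))"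
    if t: "t \<in> U" for t
  proof -
    have c: "continuous_on UNIV (\<lambda>x. I t x - I 0 x)"
      by (intro continuous_on_diff contIt t U)
    have z: "I t x - I 0 x = 0" if "x \<notin> cbox l b" for x
      using I_out(1)[of x t] lb that by auto
    have "W2 (\<Phi> t) \<tau> = (LINT x|lborel. \<tau>\<^sup>2 * I t x)"
      unfolding W2_def lam[symmetric] using I_eq[OF t] by (simp add: mult.assoc)
    also have "\<dots> = \<tau>\<^sup>2 * (LINT x|lborel. (I t x - I 0 x) + I 0 x)" by simp
    also have "(LINT x|lborel. (I t x - I 0 x) + I 0 x)
        = (LINT x|lborel. I t x - I 0 x) + (LINT x|lborel. I 0 x)"
      by (rule Bochner_Integration.integral_add[OF integrable_compact_support[OF c z] intI0])
    finally show ?thesis using integral_compact_support[OF c z] by simp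
  qed

  have "((\<lambda>t. integral (cbox l b) (\<lambda>x. I t x - I 0 x)) has_real_derivative
      integral (cbox l b) (I' 0)) (at 0 within U)"
  proof (rule leibniz_rule_field_derivative)
    show "((\<lambda>t. I t x - I 0 x) has_real_derivative I' t x) (at t within U)" if "t \<in> U" for t x
      using DERIV_diff[OF derI[OF that] DERIV_const] by (simp add: has_field_derivative_at_within)
    show "(\<lambda>x. I t x - I 0 x) integrable_on cbox l b" if "t \<in> U" for t
      by (intro integrable_continuous continuous_on_diff continuous_on_subset[OF contIt(1)] that U) auto
    show "continuous_on (U \<times> cbox l b) (\<lambda>(t, x). I' t x)"
      unfolding case_prod_unfold by (rule continuous_on_subset[OF contI(2)]) auto
  qed (use U in auto)
  then have "((\<lambda>t. integral (cbox l b) (\<lambda>x. I t x - I 0 x)) has_real_derivative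
      integral (cbox l b) (I' 0)) (at 0)"
    by (simp add: at_within_open[OF U(1,2)])
  from DERIV_cmult[OF DERIV_add[OF this DERIV_const]]
  have "((\<lambda>t. \<tau>\<^sup>2 * (integral (cbox l b) (\<lambda>x. I t x - I 0 x) + (LINT x|lborel. I 0 x)))
      has_real_derivative \<tau>\<^sup>2 * integral (cbox l b) (I' 0)) (at 0)" by simp
  then have "((\<lambda>t. W2 (\<Phi> t) \<tau>) has_real_derivative \<tau>\<^sup>2 * integral (cbox l b) (I' 0)) (at 0)"
    by (rule has_field_derivative_transform_within_open[OF _ U(2,1)]) (simp add: W2_eq)
  from DERIV_unique[OF this W2'] \<tau> have "integral (cbox l b) (I' 0) = 0" by simp
  then have intI': "(LINT x|lborel. I' 0 x) = 0"
    using integral_compact_support[OF contIt(2)[OF U(1)], of l b] I_out(2) lb by auto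

  define k where "k = (4 * pi * \<tau>) powr (- (real CARD('n) / 2))"
  \<comment> \<open>The Newton tensor with unshifted \<open>sigma1\<close>, applied to the gradient
    of \<open>u\<close>: its divergence is what separates \<open>I' 0\<close> from the claimed
    integrand.\<close>
  define V where "V i x = exp (- \<phi> x) * (\<sigma> x * pd i u x - (\<Sum>j\<in>UNIV. a i j x * pd j u x))" for i x
  have Vs: "smooth_on UNIV (V i)" for i
    unfolding V_def[abs_def] \<sigma>_def a_def
    by (intro smooth_UNIV_intros smooth_on_exp_minus smooth_on_shifted_hessian smooth_on_sigma1 s u)
  have V0: "V i x = 0" if "x \<notin> K" for i x
    using out(2)[OF that] by (simp add: V_def v_def)
  have wk: "w x = k * exp (- \<phi> x)" for x by (simp add: w_def weight_def k_def)
  have "(sigma2 lam \<phi> x - lam * sigma1 lam \<phi> x) * u x * weight \<phi> \<tau> x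
      = I' 0 x + k * (\<Sum>i\<in>UNIV. pd i (V i) x)" for x
  proof -
    have div: "(\<Sum>i\<in>UNIV. pd i (V i) x)
        = exp (- \<phi> x) * (\<sigma> x * P x - (\<Sum>i\<in>UNIV. \<Sum>j\<in>UNIV. a i j x * h i j x))"
      unfolding V_def[abs_def] a_def \<sigma>_def divergence_newton[OF s u]
      by (simp add: P_def h_def p_def v_def)
    have I'0: "I' 0 x = (\<sigma> x * (- P x - lam * u x) + (\<Sum>i\<in>UNIV. \<Sum>j\<in>UNIV. a i j x * h i j x)) * w x
        + sigma2 lam \<phi> x * (u x * w x)"
      by (simp add: I'_def S_def S'_def N_def N'_def H_def H'_def r_def r'_def \<rho>_def sigma2_eq \<sigma>_def
          a_def sum_negf sum_distrib_left[symmetric])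
    show ?thesis
      unfolding div I'0 by (simp add: w_def[symmetric] wk \<sigma>_def algebra_simps)
  qed
  then have "(LINT x|lborel. (sigma2 lam \<phi> x - lam * sigma1 lam \<phi> x) * u x * weight \<phi> \<tau> x)
      = (LINT x|lborel. I' 0 x + k * (\<Sum>i\<in>UNIV. pd i (V i) x))" by simp
  also have "\<dots> = (LINT x|lborel. I' 0 x) + k * (\<Sum>i\<in>UNIV. LINT x|lborel. pd i (V i) x)"
  proof -
    have "integrable lborel (I' 0)"
      using I_out(2) lb by (intro integrable_compact_support[OF contIt(2)[OF U(1)], of l b]) auto
    moreover have "integrable lborel (pd i (V i))" for i
      by (rule integral_pd_eq_0[OF Vs K(1) V0])
    ultimately show ?thesis by simp
  qed
  also have "\<dots> = 0" by (simp add: intI' integral_pd_eq_0(2)[OF Vs K(1) V0])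
  finally show ?thesis .
qed

section \<open>Rigidity\<close>

lemma nonneg_integral_eq_0_imp:
  fixes g :: "'a::euclidean_space \<Rightarrow> real"
  assumes g: "continuous_on UNIV g" "\<And>x. g x \<ge> 0"
    and K: "compact K" "\<And>x. x \<notin> K \<Longrightarrow> g x = 0"
    and int: "(LINT x|lborel. g x) = 0"
  shows "g x = 0"
proof -
  \<comment> \<open>The set \<open>K\<close> may be empty or thin; adjoining a ball gives the box a
    nonempty interior, so that vanishing of the integral forces the continuous function to
    vanish.\<close>
  have "compact (K \<union> cball 0 1)" using K(1) by (intro compact_Un) auto
  then obtain l u where lu: "K \<union> cball 0 1 \<subseteq> cbox l u" by (rule compact_subset_cbox)
  then have "interior (cball (0::'a) 1) \<subseteq> interior (cbox l u)" by (intro interior_mono) auto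
  then have "0 \<in> box l u" by (auto simp: interior_cbox)
  then have ne: "box l u \<noteq> {}" by auto
  have "integral (cbox l u) g = 0"
    using integral_compact_support[OF g(1), of l u] K(2) lu int by auto
  with integral_cbox_eq_0_iff[OF continuous_on_subset[OF g(1)] ne] g(2)
  have "\<forall>x\<in>cbox l u. g x = 0" by auto
  then show ?thesis using K(2)[of x] lu by auto
qed

text \<open>The fundamental lemma of the calculus of variations under an integral constraint: if f a
  > f b, a test function moving mass from near \<open>b\<close> to near \<open>a\<close> would
  contradict orthogonality. Applied to both orders of the two points it shows that \<open>f\<close>
  is constant.\<close>

lemma le_of_orthogonal:
  fixes f w :: "'a::euclidean_space \<Rightarrow> real"
  assumes f: "continuous_on UNIV f" and w: "continuous_on UNIV w" "\<And>x. w x > 0"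
    and orth: "\<And>u K. smooth_on UNIV u \<Longrightarrow> compact K \<Longrightarrow> (\<And>x. x \<notin> K \<Longrightarrow> u x = 0) \<Longrightarrow>
      (LINT x|lborel. u x * w x) = 0 \<Longrightarrow> (LINT x|lborel. f x * u x * w x) = 0"
  shows "f a \<le> f b"
proof (rule ccontr)
  assume "\<not> f a \<le> f b"
  \<comment> \<open>A level strictly between the two values. Replacing \<open>f\<close> by f - m
    leaves the integrals unchanged, since admissible test functions have weighted mean 0.\<close>
  define m where "m = (f a + f b) / 2"
  have m: "f b < m" "m < f a" using \<open>\<not> f a \<le> f b\<close> by (auto simp: m_def)
  have "open {x. f x > m}" "open {x. f x < m}"
    using f by (auto intro!: open_Collect_less simp: continuous_on_const)
  then obtain d1 d2 where d: "d1 > 0" "ball a d1 \<subseteq> {x. f x > m}" "d2 > 0" "ball b d2 \<subseteq> {x. f x < m}"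
    using m by (metis open_contains_ball mem_Collect_eq)
  define \<beta> where "\<beta> = bump a d1"
  define \<gamma> where "\<gamma> = bump b d2"
  have sm: "smooth_on UNIV \<beta>" "smooth_on UNIV \<gamma>"
    by (simp_all add: \<beta>_def \<gamma>_def smooth_on_bump)
  note cont = sm[THEN smooth_onD(2)]
  have nn: "\<beta> x \<ge> 0" "\<gamma> x \<ge> 0" for x by (simp_all add: \<beta>_def \<gamma>_def bump_nonneg)
  have supp: "\<beta> x > 0 \<longleftrightarrow> x \<in> ball a d1" "\<gamma> x > 0 \<longleftrightarrow> x \<in> ball b d2" for x
    using bump_support d(1,3) by (auto simp: \<beta>_def \<gamma>_def)
  define K where "K = cball a d1 \<union> cball b d2"
  have K: "\<beta> x = 0" "\<gamma> x = 0" if "x \<notin> K" for x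
    using that nn[of x] supp[of x] by (auto simp: K_def order_le_less)
  have Kc: "compact K" by (simp add: K_def compact_Un)
  obtain l r where lr: "K \<subseteq> cbox l r" using compact_subset_cbox[OF Kc] by blast
  have integ: "integrable lborel g" if "continuous_on UNIV g" "\<And>x. x \<notin> K \<Longrightarrow> g x = 0"
    for g :: "'a \<Rightarrow> real"
    using that lr by (intro integrable_compact_support[of _ l r]) auto
  have i: "integrable lborel (\<lambda>x. \<beta> x * w x)" "integrable lborel (\<lambda>x. \<gamma> x * w x)"
    using K by (auto intro!: integ continuous_on_mult cont w)
  define B where "B = (LINT x|lborel. \<beta> x * w x)"
  define G where "G = (LINT x|lborel. \<gamma> x * w x)"
  have "G > 0"
  proof -
    have "G \<ge> 0" unfolding G_def using nn w(2) by (intro Bochner_Integration.integral_nonneg) (auto simp: less_imp_le)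
    moreover have "G \<noteq> 0"
    proof
      assume "G = 0"
      have "\<gamma> b * w b = 0"
      proof (rule nonneg_integral_eq_0_imp[OF _ _ Kc])
        show "continuous_on UNIV (\<lambda>x. \<gamma> x * w x)" by (intro continuous_on_mult cont w)
        show "\<gamma> x * w x \<ge> 0" for x
          using nn(2)[of x] w(2)[of x] by simp
        show "\<gamma> x * w x = 0" if "x \<notin> K" for x using K(2)[OF that] by simp
        show "(LINT x|lborel. \<gamma> x * w x) = 0" using \<open>G = 0\<close> by (simp only: G_def)
      qed
      with supp(2)[of b] d(3) w(2)[of b] show False by auto
    qed
    ultimately show ?thesis by simp
  qed
  have "B \<ge> 0" unfolding B_def using nn w(2) by (intro Bochner_Integration.integral_nonneg) (auto simp: less_imp_le)
  \<comment> \<open>The coefficients balance the two masses. Positivity of \<open>G\<close> makes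
    \<open>u\<close> positive at \<open>a\<close>.\<close>
  define u where "u x = G * \<beta> x - B * \<gamma> x" for x
  have us: "smooth_on UNIV u" unfolding u_def[abs_def]
    by (intro smooth_on_diff smooth_on_mult smooth_on_const sm open_UNIV)
  note uc = smooth_onD(2)[OF us]
  have u0: "u x = 0" if "x \<notin> K" for x using K that by (simp add: u_def)
  have iu: "(LINT x|lborel. u x * w x) = 0"
  proof -
    have "(LINT x|lborel. u x * w x) = (LINT x|lborel. G * (\<beta> x * w x) - B * (\<gamma> x * w x))"
      by (simp add: u_def algebra_simps)
    also have "\<dots> = G * B - B * G" using i by (simp add: B_def G_def)
    finally show ?thesis by simp
  qed
  have "(LINT x|lborel. (f x - m) * u x * w x)
      = (LINT x|lborel. f x * u x * w x - m * (u x * w x))"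
    by (simp add: algebra_simps)
  also have "\<dots> = (LINT x|lborel. f x * u x * w x) - m * (LINT x|lborel. u x * w x)"
  proof -
    have "integrable lborel (\<lambda>x. f x * u x * w x)" "integrable lborel (\<lambda>x. u x * w x)"
      by (auto intro!: integ continuous_on_mult f uc w simp: u0)
    then show ?thesis by simp
  qed
  also have "\<dots> = 0" using orth[OF us Kc u0 iu] iu by simp
  finally have zero: "(LINT x|lborel. (f x - m) * u x * w x) = 0" .
  \<comment> \<open>On the support of either bump, f - m has the sign of that bump's coefficient, so
    an integrand with integral 0 is nonnegative and must vanish at \<open>a\<close>.\<close>
  have sgn: "(f x - m) * u x \<ge> 0" for x
  proof -
    have "\<beta> x = 0 \<or> f x - m > 0" using d(2) supp(1)[of x] nn(1)[of x] by auto
    then have "(f x - m) * \<beta> x \<ge> 0" using nn(1)[of x] by auto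
    moreover have "\<gamma> x = 0 \<or> f x - m < 0" using d(4) supp(2)[of x] nn(2)[of x] by auto
    then have "(f x - m) * \<gamma> x \<le> 0" using nn(2)[of x] by (auto simp: mult_nonpos_nonneg)
    moreover have "(f x - m) * u x = G * ((f x - m) * \<beta> x) - B * ((f x - m) * \<gamma> x)"
      by (simp add: u_def algebra_simps)
    moreover have "G * ((f x - m) * \<beta> x) \<ge> 0" "B * ((f x - m) * \<gamma> x) \<le> 0"
      using calculation \<open>G > 0\<close> \<open>B \<ge> 0\<close> by (simp_all add: mult_nonneg_nonpos)
    ultimately show ?thesis by linarith
  qed
  have "(f a - m) * u a * w a = 0"
  proof (rule nonneg_integral_eq_0_imp[OF _ _ Kc _ zero])
    show "continuous_on UNIV (\<lambda>x. (f x - m) * u x * w x)"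
      by (intro continuous_intros f uc w)
    show "0 \<le> (f x - m) * u x * w x" for x
      using sgn[of x] w(2)[of x] by (simp add: less_imp_le)
  qed (simp add: u0)
  then have "u a = 0" using m w(2)[of a] by auto
  moreover have "a \<notin> ball b d2" using d(4) m(2) by fastforce
  with supp(2)[of a] nn(2)[of a] have "\<gamma> a = 0" by linarith
  moreover have "\<beta> a > 0" using supp(1)[of a] d(1) by simp
  ultimately show False using \<open>G > 0\<close> by (simp add: u_def)
qed

lemma pd_eq_0_imp_const:
  assumes f: "smooth_on UNIV f" and z: "\<And>i x. pd i f x = 0"
  shows "f x = f y"
proof -
  have "(f has_derivative (\<lambda>h. 0)) (at x)" for x
  proof -
    note d = smooth_differentiable[OF f, of x]
    have "frechet_derivative f (at x) h = 0" for h
    proof -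
      have "frechet_derivative f (at x) b = 0" if "b \<in> Basis" for b
        using that z unfolding partial_deriv_def by (auto simp: Basis_vec_def)
      then have "frechet_derivative f (at x) (\<Sum>b\<in>Basis. (h \<bullet> b) *\<^sub>R b) = 0"
        by (simp add: linear_sum[OF linear_frechet_derivative[OF d]]
            linear_scale[OF linear_frechet_derivative[OF d]])
      then show ?thesis by (simp add: euclidean_representation)
    qed
    then have "frechet_derivative f (at x) = (\<lambda>h. 0)" by auto
    with has_derivative_frechet[OF d] show ?thesis by simp
  qed
  with has_derivative_zero_constant[of UNIV f] show ?thesis by auto
qed

section \<open>Matrix inequalities inside the cone\<close>

lemma cubic_trace_le:
  fixes a :: "'n::finite \<Rightarrow> 'n \<Rightarrow> real"
  defines "N \<equiv> \<Sum>i\<in>UNIV. \<Sum>j\<in>UNIV. a i j * a i j"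
  shows "\<bar>\<Sum>i\<in>UNIV. \<Sum>j\<in>UNIV. (\<Sum>k\<in>UNIV. a i k * a k j) * a i j\<bar> \<le> N * sqrt N"
proof -
  define m where "m i j = (\<Sum>k\<in>UNIV. a i k * a k j)" for i j
  have N: "N = (\<Sum>i\<in>UNIV. \<Sum>k\<in>UNIV. (a i k)\<^sup>2)" by (simp add: N_def power2_eq_square)
  have N0: "N \<ge> 0" by (simp add: N sum_nonneg)
  \<comment> \<open>Submultiplicativity of the Frobenius norm, from Cauchy-Schwarz for rows against
    columns; a second Cauchy-Schwarz then pairs the product matrix with the matrix itself.\<close>
  have "(\<Sum>i\<in>UNIV. \<Sum>j\<in>UNIV. (m i j)\<^sup>2)
      \<le> (\<Sum>i\<in>UNIV. \<Sum>j\<in>UNIV. (\<Sum>k\<in>UNIV. (a i k)\<^sup>2) * (\<Sum>k\<in>UNIV. (a k j)\<^sup>2))"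
    unfolding m_def by (intro sum_mono Cauchy_Schwarz_ineq_sum)
  also have "\<dots> = N * (\<Sum>j\<in>UNIV. \<Sum>k\<in>UNIV. (a k j)\<^sup>2)"
    by (simp only: sum_distrib_left[symmetric] sum_distrib_right[symmetric] N)
  also have "(\<Sum>j\<in>UNIV. \<Sum>k\<in>UNIV. (a k j)\<^sup>2) = N" unfolding N by (rule sum.swap)
  finally have m2: "(\<Sum>i\<in>UNIV. \<Sum>j\<in>UNIV. (m i j)\<^sup>2) \<le> N * N" .
  have "(\<Sum>i\<in>UNIV. \<Sum>j\<in>UNIV. m i j * a i j)\<^sup>2
      \<le> (\<Sum>i\<in>UNIV. \<Sum>j\<in>UNIV. (m i j)\<^sup>2) * (\<Sum>i\<in>UNIV. \<Sum>j\<in>UNIV. (a i j)\<^sup>2)"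
    using Cauchy_Schwarz_ineq_sum[of "\<lambda>(i, j). m i j" "\<lambda>(i, j). a i j" "UNIV \<times> UNIV"]
    by (simp add: sum.cartesian_product case_prod_unfold)
  also have "\<dots> \<le> (N * N) * N" unfolding N[symmetric] using m2 N0 by (intro mult_right_mono)
  also have "\<dots> = (N * sqrt N)\<^sup>2" using N0 by (simp add: power_mult_distrib power2_eq_square)
  finally have "\<bar>\<Sum>i\<in>UNIV. \<Sum>j\<in>UNIV. m i j * a i j\<bar> \<le> \<bar>N * sqrt N\<bar>"
    by (simp only: abs_le_square_iff)
  also have "\<bar>N * sqrt N\<bar> = N * sqrt N" using N0 by simp
  finally show ?thesis by (simp only: m_def)
qed

text \<open>By \<open>cubic_trace_le\<close> the form is at most N (s + sqrt N). The second factor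
  is strictly negative inside the cone, and this strictness settles the equality case.\<close>

lemma newton_hessian_inner_neg:
  fixes a :: "'n::finite \<Rightarrow> 'n \<Rightarrow> real" and s :: real
  defines "N \<equiv> \<Sum>i\<in>UNIV. \<Sum>j\<in>UNIV. a i j * a i j"
  defines "g \<equiv> \<Sum>i\<in>UNIV. \<Sum>j\<in>UNIV. (s * a i j - (\<Sum>k\<in>UNIV. a i k * a k j)) * a i j"
  assumes s: "s < 0" "N < s\<^sup>2"
  shows "g \<le> 0" and "g = 0 \<Longrightarrow> a i j = 0"
proof -
  have N0: "N \<ge> 0" by (simp add: N_def sum_nonneg)
  have "sqrt N < \<bar>s\<bar>" using s(2) real_sqrt_less_mono[of N "s\<^sup>2"] by simp
  then have neg: "s + sqrt N < 0" using s(1) by simp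
  have "g = s * N - (\<Sum>i\<in>UNIV. \<Sum>j\<in>UNIV. (\<Sum>k\<in>UNIV. a i k * a k j) * a i j)"
    by (simp add: g_def N_def left_diff_distrib sum_subtractf sum_distrib_left mult.assoc)
  also have "\<dots> \<le> s * N + N * sqrt N"
    using cubic_trace_le[of a] by (simp add: N_def[symmetric])
  finally have le: "g \<le> N * (s + sqrt N)" by (simp add: algebra_simps)
  also have "\<dots> \<le> 0" using N0 neg by (simp add: mult_nonneg_nonpos)
  finally show "g \<le> 0" .
  assume "g = 0"
  with le neg N0 have "N = 0"
    by (metis less_le mult_pos_neg not_le)
  then have "\<forall>i. (\<Sum>j\<in>UNIV. a i j * a i j) = 0"
    unfolding N_def by (subst (asm) sum_nonneg_eq_0_iff) (auto intro: sum_nonneg)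
  then have "\<forall>i j. a i j * a i j = 0"
    by (subst (asm) sum_nonneg_eq_0_iff) auto
  then show "a i j = 0" by simp
qed

text \<open>The polynomial is the one for the derivative of \<open>flat_exp 1\<close>. The gradient
  is kept as a multiple of x instead of being bounded by 1 / R: moving x into the integrand leaves
  the full factor 1 / R^2 in front.\<close>

lemma pd_bump:
  "pd i (bump 0 R) x = - (2 / R\<^sup>2) * (flat_exp ([:0, 0, 1:] * (1 - pderiv 1)) (1 - inverse (R\<^sup>2) * (norm x)\<^sup>2) * x $ i)"
proof -
  have d: "((\<lambda>x. 1 - inverse (R\<^sup>2) * (norm x)\<^sup>2) has_derivative (\<lambda>v. - (inverse (R\<^sup>2) * (2 * (x \<bullet> v))))) (at x)"
    unfolding power2_norm_eq_inner
    by (auto intro!: derivative_eq_intros simp: inner_commute)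
  have "pd i (\<lambda>x. flat_exp 1 (1 - inverse (R\<^sup>2) * (norm x)\<^sup>2)) x
    = flat_exp ([:0, 0, 1:] * (1 - pderiv 1)) (1 - inverse (R\<^sup>2) * (norm x)\<^sup>2)
      * - (inverse (R\<^sup>2) * (2 * (x \<bullet> axis i 1)))"
    using partial_deriv_real_compose[OF differentiableI[OF d] flat_exp_has_derivative]
      partial_deriv_eqI[OF d] by metis
  then show ?thesis
    by (simp add: bump_def[abs_def] inner_axis divide_inverse mult_ac del: mult_pCons_left)
qed

text \<open>The function vanishes for negative arguments, so compactness of the unit interval
  suffices. Cutoffs are only evaluated at arguments up to 1, hence the bound is uniform in the
  radius.\<close>

lemma flat_exp_bounded:
  obtains M where "M \<ge> 0" "\<And>y. y \<le> 1 \<Longrightarrow> \<bar>flat_exp p y\<bar> \<le> M"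
proof -
  have "compact (flat_exp p ` {0..1})"
    by (intro compact_continuous_image continuous_on_flat_exp continuous_on_id) simp
  then obtain B where B: "\<forall>z\<in>flat_exp p ` {0..1}. norm z \<le> B"
    using compact_imp_bounded bounded_iff by blast
  show ?thesis
  proof
    show "\<bar>B\<bar> \<ge> 0" by simp
    show "\<bar>flat_exp p y\<bar> \<le> \<bar>B\<bar>" if "y \<le> 1" for y
    proof (cases "y > 0")
      case True
      then have "\<bar>flat_exp p y\<bar> \<le> B" using B that by auto
      then show ?thesis by linarith
    next
      case False
      then show ?thesis by (simp add: flat_exp_def)
    qed
  qed
qed

text \<open>Lets an integral with a fixed cutoff be dominated by those with larger radii, as the
  radius tends to infinity.\<close>

lemma bump_mono:
  assumes "0 < R" "R \<le> R'"
  shows "bump p R x \<le> bump p R' x"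
proof -
  have "inverse (R'\<^sup>2) \<le> inverse (R\<^sup>2)"
    using assms by (intro le_imp_inverse_le power_mono) auto
  then have "inverse (R'\<^sup>2) * (norm (x - p))\<^sup>2 \<le> inverse (R\<^sup>2) * (norm (x - p))\<^sup>2"
    by (rule mult_right_mono) simp
  then show ?thesis unfolding bump_def by (intro flat_exp_1_mono) simp
qed

lemma bump_outside: "R > 0 \<Longrightarrow> x \<notin> cball p R \<Longrightarrow> bump p R x = 0"
  using bump_support[of R p x] bump_nonneg[of p R x] by (auto simp: order_le_less)

text \<open>With \<open>z = \<phi> - lam |x|\<^sup>2 / 2\<close>, the field \<open>exp (- \<phi>) T A \<nabla>z\<close> has divergence
  \<open>exp (- \<phi>) \<langle>T A, A\<rangle> \<le> 0\<close>. Integrated against a cutoff of radius \<open>R\<close> it gives \<open>O(R\<^sup>-\<^sup>2)\<close>.\<close>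

lemma shifted_hessian_eq_0:
  fixes \<phi> :: "real ^ 'n \<Rightarrow> real"
  assumes s: "smooth_on UNIV \<phi>"
    and const: "\<And>j x. pd j (\<lambda>x. sigma2 lam \<phi> x - lam * sigma1 lam \<phi> x) x = 0"
    and neg: "\<And>x. sigma1 lam \<phi> x < lam"
    and cone: "\<And>x. (\<Sum>i\<in>UNIV. \<Sum>j\<in>UNIV. shifted_hessian lam \<phi> i j x * shifted_hessian lam \<phi> i j x)
        < (sigma1 lam \<phi> x - lam)\<^sup>2"
    and growth: "poly_growth \<phi>" "\<And>i. poly_growth (pd i \<phi>)" "\<And>i j. poly_growth (pd i (pd j \<phi>))"
    and low: "c > 0" "\<And>x. \<phi> x \<ge> c * (norm x)\<^sup>2 - C"
  shows "shifted_hessian lam \<phi> i j x = 0"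
proof -
  define A where "A = shifted_hessian lam \<phi>"
  define B where "B = newton_hessian lam \<phi>"
  define E where "E x = exp (- \<phi> x)" for x
  define Z where "Z j x = pd j \<phi> x - lam * x $ j" for j x
  define W where "W i x = (\<Sum>j\<in>UNIV. B i j x * Z j x)" for i x
  \<comment> \<open>\<open>W\<close> is T A applied to the gradient of z, and \<open>X\<close> is
    its product with x. This is all that survives when the derivative falls on the radial
    cutoff.\<close>
  define X where "X x = (\<Sum>i\<in>UNIV. x $ i * W i x)" for x
  define g where "g x = (\<Sum>i\<in>UNIV. \<Sum>j\<in>UNIV. B i j x * A i j x)" for x
  define q where "q = ([:0, 0, 1:] * (1 - pderiv 1) :: real poly)"

  note inner_neg = newton_hessian_inner_neg[where s = "sigma1 lam \<phi> y - lam" and a = "\<lambda>i j. A i j y" for y,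
      folded A_def, OF _ cone[folded A_def]]
  have g_alt: "g x = (\<Sum>i\<in>UNIV. \<Sum>j\<in>UNIV. ((sigma1 lam \<phi> x - lam) * A i j x
      - (\<Sum>k\<in>UNIV. A i k x * A k j x)) * A i j x)" for x
    unfolding g_def B_def newton_hessian_def A_def[symmetric] ..
  have g_le: "g x \<le> 0" and g_eq: "g x = 0 \<Longrightarrow> A i j x = 0" for x i j
    unfolding g_alt using neg[of x] by (auto intro: inner_neg)
  have smA: "smooth_on UNIV (A i j)" and smB: "smooth_on UNIV (B i j)" for i j
    unfolding A_def B_def by (intro smooth_on_shifted_hessian smooth_on_newton_hessian s)+
  have smE: "smooth_on UNIV E" unfolding E_def[abs_def] by (rule smooth_on_exp_minus[OF s])
  have smZ: "smooth_on UNIV (Z j)" for j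
    unfolding Z_def[abs_def] by (intro smooth_UNIV_intros s)
  note sm = smooth_UNIV_intros s smA smB smE smZ
  have smW: "smooth_on UNIV (W i)" for i unfolding W_def[abs_def] by (intro sm)
  have smX: "smooth_on UNIV X" unfolding X_def[abs_def] by (intro sm smW)
  have smg: "smooth_on UNIV g" unfolding g_def[abs_def] by (intro sm)
  have Zd: "pd i (Z j) x = A i j x" for i j x
    unfolding Z_def[abs_def] A_def shifted_hessian_def by (simp add: pd_simps sm pd_component)
  have Ed: "pd i E x = - pd i \<phi> x * E x" for i x
    unfolding E_def[abs_def] by (rule pd_exp_minus[OF s])

  have pgA: "poly_growth (A i j)" for i j
    unfolding A_def shifted_hessian_def[abs_def] by (intro poly_growth_intros growth)
  have pg\<sigma>: "poly_growth (sigma1 lam \<phi>)"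
    unfolding sigma1_eq[abs_def] by (intro poly_growth_intros growth)
  have pgB: "poly_growth (B i j)" for i j
    unfolding B_def newton_hessian_def[abs_def] A_def[symmetric]
    by (intro poly_growth_intros pgA pg\<sigma>)
  have pgx: "poly_growth (\<lambda>x. x $ i)" for i :: 'n
    using poly_growth_inner[of "axis i (1::real)"] by (simp add: cart_eq_inner_axis[symmetric])
  have pgX: "poly_growth X"
    unfolding X_def[abs_def] W_def Z_def by (intro poly_growth_intros pgx pgB growth)
  \<comment> \<open>Polynomial growth against Gaussian decay: this gives a bound for the boundary
    term that does not depend on the radius.\<close>
  have "integrable lborel (\<lambda>x. X x * exp (- \<phi> x))"
    by (rule integrable_poly_growth_exp[OF smooth_onD(2)[OF smX] pgX smooth_onD(2)[OF s] low])
  then have XE: "integrable lborel (\<lambda>x. X x * E x)" by (simp add: E_def)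
  define J where "J = (LINT x|lborel. \<bar>X x * E x\<bar>)"
  have J: "J \<ge> 0" unfolding J_def by (intro Bochner_Integration.integral_nonneg) simp

  obtain M where M: "M \<ge> 0" "\<And>y. y \<le> 1 \<Longrightarrow> \<bar>flat_exp q y\<bar> \<le> M"
    using flat_exp_bounded by blast

  have bound: "(LINT x|lborel. bump 0 R x * (E x * (- g x))) \<le> 2 * M * J / R\<^sup>2" if R: "R > 0" for R
  proof -
    define \<eta> :: "real ^ 'n \<Rightarrow> real" where "\<eta> = bump 0 R"
    have \<eta>: "smooth_on UNIV \<eta>" "\<And>x. x \<notin> cball 0 R \<Longrightarrow> \<eta> x = 0"
      unfolding \<eta>_def by (rule smooth_on_bump, rule bump_outside[OF R])
    define F where "F i x = \<eta> x * (E x * W i x)" for i x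
    have smF: "smooth_on UNIV (F i)" for i unfolding F_def[abs_def] by (intro sm smW \<eta>)
    have F0: "F i x = 0" if "x \<notin> cball 0 R" for i x using \<eta>(2)[OF that] by (simp add: F_def)
    have dF: "(\<Sum>i\<in>UNIV. pd i (F i) x)
      = - (2 / R\<^sup>2) * flat_exp q (1 - inverse (R\<^sup>2) * (norm x)\<^sup>2) * (X x * E x)
        + \<eta> x * (E x * g x)" for x
    proof -
      have W': "pd i (W i) x = (\<Sum>j\<in>UNIV. pd i (B i j) x * Z j x) + (\<Sum>j\<in>UNIV. B i j x * A i j x)" for i
        unfolding W_def[abs_def] by (simp add: pd_simps sm Zd sum.distrib)
      have "pd i (F i) x = E x * (pd i \<eta> x * W i x) + \<eta> x * (E x * (\<Sum>j\<in>UNIV. B i j x * A i j x))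
          + \<eta> x * (E x * (\<Sum>j\<in>UNIV. (pd i (B i j) x - pd i \<phi> x * B i j x) * Z j x))" for i
        unfolding F_def[abs_def]
        by (simp add: pd_simps sm smW \<eta>(1) Ed W')
          (simp add: W_def left_diff_distrib sum_subtractf sum_distrib_left algebra_simps)
      then have "(\<Sum>i\<in>UNIV. pd i (F i) x) = E x * (\<Sum>i\<in>UNIV. pd i \<eta> x * W i x) + \<eta> x * (E x * g x)
          + \<eta> x * (E x * (\<Sum>i\<in>UNIV. \<Sum>j\<in>UNIV. (pd i (B i j) x - pd i \<phi> x * B i j x) * Z j x))"
        by (simp add: sum.distrib g_def sum_distrib_left)
      also have "(\<Sum>i\<in>UNIV. \<Sum>j\<in>UNIV. (pd i (B i j) x - pd i \<phi> x * B i j x) * Z j x)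
          = (\<Sum>j\<in>UNIV. (\<Sum>i\<in>UNIV. pd i (B i j) x - pd i \<phi> x * B i j x) * Z j x)"
        by (subst sum.swap) (simp add: sum_distrib_right)
      \<comment> \<open>The Euler-Lagrange equation enters here: the weighted divergence of T A is
        the gradient of a constant.\<close>
      also have "\<dots> = 0"
        unfolding B_def divergence_newton_hessian[OF s] const by simp
      also have "(\<Sum>i\<in>UNIV. pd i \<eta> x * W i x)
          = - (2 / R\<^sup>2) * flat_exp q (1 - inverse (R\<^sup>2) * (norm x)\<^sup>2) * X x"
        unfolding \<eta>_def pd_bump q_def[symmetric] X_def
        by (simp add: sum_distrib_left sum_distrib_right sum_divide_distrib sum_negf mult_ac)
      finally show ?thesis by (simp add: mult_ac)
    qed
    let ?G = "\<lambda>x. (2 / R\<^sup>2) * flat_exp q (1 - inverse (R\<^sup>2) * (norm x)\<^sup>2) * (X x * E x)"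
    have le: "\<bar>?G x\<bar> \<le> (2 / R\<^sup>2 * M) * \<bar>X x * E x\<bar>" for x
    proof -
      have "\<bar>flat_exp q (1 - inverse (R\<^sup>2) * (norm x)\<^sup>2)\<bar> \<le> M" by (rule M(2)) simp
      then have "(2 / R\<^sup>2) * \<bar>flat_exp q (1 - inverse (R\<^sup>2) * (norm x)\<^sup>2)\<bar> \<le> 2 / R\<^sup>2 * M"
        by (intro mult_left_mono) auto
      then have "(2 / R\<^sup>2) * \<bar>flat_exp q (1 - inverse (R\<^sup>2) * (norm x)\<^sup>2)\<bar> * \<bar>X x * E x\<bar>
          \<le> 2 / R\<^sup>2 * M * \<bar>X x * E x\<bar>" by (rule mult_right_mono) simp
      then show ?thesis by (simp add: abs_mult)
    qed
    have Gc: "continuous_on UNIV ?G"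
      by (intro continuous_intros smooth_onD(2)[OF smX] smooth_onD(2)[OF smE])
    have iM: "integrable lborel (\<lambda>x. (2 / R\<^sup>2 * M) * \<bar>X x * E x\<bar>)"
      using XE by (intro integrable_mult_right integrable_abs)
    have iG: "integrable lborel ?G"
    proof (rule Bochner_Integration.integrable_bound[OF iM])
      show "?G \<in> borel_measurable lborel" using borel_measurable_continuous_onI[OF Gc] by simp
      show "AE x in lborel. norm (?G x) \<le> norm ((2 / R\<^sup>2 * M) * \<bar>X x * E x\<bar>)"
        using le M(1) by (intro AE_I2) (simp add: abs_mult)
    qed
    obtain l u where lu: "cball (0 :: real ^ 'n) R \<subseteq> cbox l u"
      using compact_subset_cbox[OF compact_cball] by blast
    have i\<eta>: "integrable lborel (\<lambda>x. \<eta> x * (E x * g x))"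
    proof (rule integrable_compact_support[of _ l u])
      show "continuous_on UNIV (\<lambda>x. \<eta> x * (E x * g x))" by (intro smooth_onD(2) sm smg \<eta>(1))
      show "\<eta> x * (E x * g x) = 0" if "x \<notin> cbox l u" for x
        using \<eta>(2)[of x] lu that by fastforce
    qed
    have "(LINT x|lborel. pd i (F i) x) = 0" for i
      by (rule integral_pd_eq_0(2)[OF smF compact_cball F0])
    then have "0 = (\<Sum>i\<in>UNIV. LINT x|lborel. pd i (F i) x)" by simp
    also have "\<dots> = (LINT x|lborel. (\<Sum>i\<in>UNIV. pd i (F i) x))"
      by (rule Bochner_Integration.integral_sum[symmetric])
        (rule integral_pd_eq_0(1)[OF smF compact_cball F0])
    also have "\<dots> = (LINT x|lborel. \<eta> x * (E x * g x) - ?G x)"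
      unfolding dF by (intro Bochner_Integration.integral_cong) (simp_all add: algebra_simps)
    also have "\<dots> = (LINT x|lborel. \<eta> x * (E x * g x)) - (LINT x|lborel. ?G x)"
      by (rule Bochner_Integration.integral_diff[OF i\<eta> iG])
    finally have "(LINT x|lborel. \<eta> x * (E x * (- g x))) = - (LINT x|lborel. ?G x)"
      by simp
    also have "\<dots> \<le> \<bar>LINT x|lborel. ?G x\<bar>" by (rule abs_ge_minus_self)
    also have "\<dots> \<le> (LINT x|lborel. (2 / R\<^sup>2 * M) * \<bar>X x * E x\<bar>)"
      by (intro order_trans[OF integral_abs_bound] Bochner_Integration.integral_mono le
          integrable_abs iG iM)
    also have "\<dots> = 2 * M * J / R\<^sup>2" by (simp add: J_def)
    finally show ?thesis by (simp add: \<eta>_def)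
  qed

  \<comment> \<open>Any radius beyond |x| makes the cutoff positive at the given point.\<close>
  define R0 where "R0 = norm x + 1"
  have R0: "R0 \<ge> 1" by (simp add: R0_def)
  define f where "f R y = bump 0 R y * (E y * (- g y))" for R and y :: "real ^ 'n"
  have fc: "continuous_on UNIV (f R)" for R
    unfolding f_def[abs_def]
    by (intro continuous_on_mult continuous_on_minus smooth_onD(2)[OF smooth_on_bump]
        smooth_onD(2)[OF smE] smooth_onD(2)[OF smg])
  have f0: "f R y \<ge> 0" for R y
    unfolding f_def using g_le bump_nonneg by (intro mult_nonneg_nonneg) (auto simp: E_def)
  have fout: "f R y = 0" if "R > 0" "y \<notin> cball 0 R" for R y
    using bump_outside[OF that] by (simp add: f_def)
  have fi: "integrable lborel (f R)" if "R > 0" for R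
  proof -
    obtain l u where lu: "cball (0 :: real ^ 'n) R \<subseteq> cbox l u"
      using compact_subset_cbox[OF compact_cball] by blast
    have "f R y = 0" if "y \<notin> cbox l u" for y
      by (rule fout[OF \<open>R > 0\<close>]) (use lu that in blast)
    then show ?thesis by (rule integrable_compact_support[OF fc])
  qed
  define I where "I = (LINT y|lborel. f R0 y)"
  have I_le: "I * R\<^sup>2 \<le> 2 * M * J" if "R \<ge> R0" for R
  proof -
    have R: "R > 0" using that R0 by simp
    have "I \<le> (LINT y|lborel. f R y)"
      unfolding I_def
    proof (intro Bochner_Integration.integral_mono fi R)
      show "0 < R0" using R0 by simp
      show "f R0 y \<le> f R y" for y
        unfolding f_def using that R0 g_le[of y]
        by (intro mult_right_mono bump_mono mult_nonneg_nonneg) (auto simp: E_def)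
    qed
    also have "\<dots> \<le> 2 * M * J / R\<^sup>2" unfolding f_def by (rule bound[OF R])
    finally show ?thesis using R by (simp add: field_simps)
  qed
  have "I \<ge> 0" unfolding I_def using f0 by (intro Bochner_Integration.integral_nonneg)
  have "I = 0"
  proof (rule ccontr)
    assume "I \<noteq> 0"
    with \<open>I \<ge> 0\<close> have pos: "I > 0" by simp
    \<comment> \<open>Large enough to violate \<open>I_le\<close>: it exceeds 2 M J / I, and R \<le>
      R^2 because R is at least 1.\<close>
    define R where "R = R0 + 2 * M * J / I"
    have nn: "2 * M * J / I \<ge> 0" using M(1) J pos by simp
    then have "R \<ge> R0" "R \<ge> 1" using R0 by (auto simp: R_def)
    have "2 * M * J / I < R" using R0 by (simp add: R_def)
    also have "\<dots> \<le> R\<^sup>2" using \<open>R \<ge> 1\<close> by (simp add: power2_eq_square)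
    finally have "2 * M * J < I * R\<^sup>2" using pos by (simp add: field_simps)
    with I_le[OF \<open>R \<ge> R0\<close>] show False by simp
  qed
  have "f R0 x = 0"
  proof (rule nonneg_integral_eq_0_imp[OF fc f0 compact_cball])
    show "f R0 y = 0" if "y \<notin> cball 0 R0" for y
      by (rule fout[OF _ that]) (use R0 in linarith)
    show "(LINT y|lborel. f R0 y) = 0" using \<open>I = 0\<close> by (simp only: I_def)
  qed
  moreover have "bump 0 R0 x > 0" using R0 by (subst bump_support) (auto simp: R0_def add_nonneg_pos)
  ultimately have "g x = 0" by (simp add: f_def E_def)
  then show ?thesis using g_eq by (simp add: A_def)
qed

theorem theorem1p2:
  fixes \<phi> :: "real ^ 'n \<Rightarrow> real" and \<tau> :: real
  assumes "(\<phi>, \<tau>) \<in> C1_space"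
    and "W2_critical \<phi> \<tau>"
    and "\<And>x. sigma1 (1 / (2 * \<tau>)) \<phi> x < 1 / (2 * \<tau>)"
    and "\<And>x. sigma2 (1 / (2 * \<tau>)) \<phi> x
               > 1 / (2 * \<tau>) * sigma1 (1 / (2 * \<tau>)) \<phi> x - 1 / (8 * \<tau>\<^sup>2)"
    and "\<exists>\<psi>. C_k_on 2 UNIV \<psi> \<and>
             (\<forall>x. x \<noteq> 0 \<longrightarrow> \<psi> x = (norm x)\<^sup>2 * \<phi> (x /\<^sub>R (norm x)\<^sup>2)) \<and>
             \<psi> 0 > 0"
  shows "\<exists>x\<^sub>0. \<forall>x. \<phi> x = (norm (x - x\<^sub>0))\<^sup>2 / (4 * \<tau>)"
proof -
  define lam where "lam = 1 / (2 * \<tau>)"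
  have s: "smooth_on UNIV \<phi>" and \<tau>: "\<tau> > 0" and one: "(LINT x|lborel. weight \<phi> \<tau> x) = 1"
    using assms(1) by (auto simp: C1_space_def)
  have lam: "lam > 0" using \<tau> by (simp add: lam_def)
  obtain \<psi> where \<psi>: "C_k_on 2 UNIV \<psi>"
    "\<And>x. x \<noteq> 0 \<Longrightarrow> \<psi> x = (norm x)\<^sup>2 * \<phi> (x /\<^sub>R (norm x)\<^sup>2)" "\<psi> 0 > 0"
    using assms(5) by blast
  have \<phi>2: "C_k_on 2 UNIV \<phi>" using s by (simp only: smooth_on_def)
  note growth = inversion_growth[OF \<phi>2 \<psi>] inversion_growth_1[OF \<phi>2 \<psi> axis_1_in_Basis]
    inversion_growth_2[OF \<phi>2 \<psi> axis_1_in_Basis axis_1_in_Basis]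
  obtain c C where low: "c > 0" "\<And>x. \<phi> x \<ge> c * (norm x)\<^sup>2 - C"
    using inversion_lower_bound[OF \<phi>2 \<psi>] by blast

  have pgA: "poly_growth (shifted_hessian lam \<phi> i j)" for i j
    unfolding shifted_hessian_def[abs_def] by (intro poly_growth_intros growth)
  have pg1: "poly_growth (sigma1 lam \<phi>)"
    unfolding sigma1_eq[abs_def] by (intro poly_growth_intros growth)
  have "poly_growth (sigma2 lam \<phi>)"
    unfolding sigma2_eq[abs_def] power2_eq_square by (intro poly_growth_intros pg1 pgA)
  from integrable_poly_growth_exp[OF smooth_onD(2)[OF smooth_on_sigma2[OF s]] this smooth_onD(2)[OF s] low]
  have int: "integrable lborel (\<lambda>x. sigma2 lam \<phi> x * weight \<phi> \<tau> x)"
    unfolding weight_def by (subst mult.left_commute) (rule integrable_mult_right)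

  define f where "f x = sigma2 lam \<phi> x - lam * sigma1 lam \<phi> x" for x
  have fs: "smooth_on UNIV f"
    unfolding f_def[abs_def] by (intro smooth_UNIV_intros smooth_on_sigma1 smooth_on_sigma2 s)
  have "f a \<le> f b" for a b
  proof (rule le_of_orthogonal[OF smooth_onD(2)[OF fs] smooth_onD(2)[OF smooth_on_weight[OF s]]])
    show "weight \<phi> \<tau> x > 0" for x by (rule weight_pos[OF \<tau>])
    show "(LINT x|lborel. f x * u x * weight \<phi> \<tau> x) = 0"
      if "smooth_on UNIV u" "compact K" "\<And>x. x \<notin> K \<Longrightarrow> u x = 0"
        "(LINT x|lborel. u x * weight \<phi> \<tau> x) = 0" for u K
      unfolding f_def by (rule first_variation[OF assms(1,2) lam_def int that])
  qed
  \<comment> \<open>The inequality holds for every ordered pair of points, hence is an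
    equality.\<close>
  then have "f = (\<lambda>x. f 0)" using antisym by blast
  then have const: "pd j (\<lambda>x. sigma2 lam \<phi> x - lam * sigma1 lam \<phi> x) x = 0" for j x
    unfolding f_def[symmetric] using partial_deriv_const[of "axis j 1" "f 0" x] by simp

  have cone: "(\<Sum>i\<in>UNIV. \<Sum>j\<in>UNIV. shifted_hessian lam \<phi> i j x * shifted_hessian lam \<phi> i j x)
      < (sigma1 lam \<phi> x - lam)\<^sup>2" for x
  proof -
    \<comment> \<open>Here 1 / (8 \<tau>^2) is lam^2 / 2, the term that completes the square of
      \<open>sigma1 lam \<phi> x - lam\<close>.\<close>
    have "sigma2 lam \<phi> x > lam * sigma1 lam \<phi> x - lam\<^sup>2 / 2"
      using assms(4)[of x] \<tau> by (simp add: lam_def power2_eq_square)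
    then show ?thesis by (simp add: sigma2_eq power2_eq_square algebra_simps)
  qed
  have A0: "shifted_hessian lam \<phi> i j x = 0" for i j x
    by (rule shifted_hessian_eq_0[OF s const _ cone growth low])
      (use assms(3) in \<open>simp add: lam_def\<close>)

  \<comment> \<open>With vanishing shifted Hessian the gradient of \<open>\<phi>\<close> is affine
    with linear part lam x; \<open>x0\<close> is its zero, computed from the value at the
    origin.\<close>
  define x0 where "x0 = (\<chi> j. - pd j \<phi> 0 / lam)"
  have grad: "pd j \<phi> x = lam * (x $ j - x0 $ j)" for j x
  proof -
    have sm: "smooth_on UNIV (\<lambda>x. pd j \<phi> x - lam * x $ j)" by (intro smooth_UNIV_intros s)
    have "pd i (\<lambda>x. pd j \<phi> x - lam * x $ j) x = 0" for i x
      using A0[of i j x] by (simp add: pd_simps smooth_UNIV_intros s pd_component shifted_hessian_def)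
    from pd_eq_0_imp_const[OF sm this, of x 0] show ?thesis
      using lam by (simp add: x0_def field_simps)
  qed
  define h where "h x = \<phi> x - lam / 2 * (norm (x - x0))\<^sup>2" for x
  have n2: "smooth_on UNIV (\<lambda>x. (norm (x - x0))\<^sup>2)" by (rule smooth_on_norm_power2)
  have dn: "pd j (\<lambda>x. (norm (x - x0))\<^sup>2) x = 2 * (x $ j - x0 $ j)" for j x
  proof -
    have "((\<lambda>x. (norm (x - x0))\<^sup>2) has_derivative (\<lambda>v. 2 * ((x - x0) \<bullet> v))) (at x)"
      unfolding power2_norm_eq_inner
      by (auto intro!: derivative_eq_intros simp: inner_commute)
    from partial_deriv_eqI[OF this] show ?thesis by (simp add: inner_axis)
  qed
  have hs: "smooth_on UNIV h" unfolding h_def[abs_def] by (intro smooth_UNIV_intros s n2)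
  have "pd j h x = 0" for j x
    unfolding h_def[abs_def] by (simp add: pd_simps smooth_UNIV_intros s n2 dn grad)
  from pd_eq_0_imp_const[OF hs this, of _ 0]
  have rep: "\<phi> x = lam / 2 * (norm (x - x0))\<^sup>2 + h 0" for x
    unfolding h_def by (simp add: algebra_simps)

  \<comment> \<open>Since lam / 2 = 1 / (4 \<tau>), the Gaussian has total mass (4 pi \<tau>)^(n/2),
    which cancels the prefactor of the weight. Normalisation then reads exp (- h 0) = 1.\<close>
  let ?k = "(4 * pi * \<tau>) powr - (real CARD('n) / 2)"
  have "weight \<phi> \<tau> x = (?k * exp (- h 0)) * exp (- (lam / 2 * (norm (x - x0))\<^sup>2))" for x
    unfolding weight_def rep[of x] by (simp add: exp_add[symmetric] mult.assoc)
  then have "1 = (LINT x|lborel. (?k * exp (- h 0)) * exp (- (lam / 2 * (norm (x - x0))\<^sup>2)))"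
    using one by simp
  also have "\<dots> = (?k * exp (- h 0)) * sqrt (pi / (lam / 2)) ^ CARD('n)"
    using has_bochner_integral_integral_eq[OF has_bochner_integral_gaussian[of "lam / 2" x0]] lam
    by simp
  also have "sqrt (pi / (lam / 2)) ^ CARD('n) = (4 * pi * \<tau>) powr (real CARD('n) / 2)"
    using \<tau> by (simp add: lam_def powr_half_sqrt[symmetric] powr_realpow[symmetric] powr_powr mult_ac)
  also have "(?k * exp (- h 0)) * (4 * pi * \<tau>) powr (real CARD('n) / 2) = exp (- h 0)"
    using \<tau> by (simp add: powr_minus field_simps)
  finally have "h 0 = 0" by simp
  with rep show ?thesis using \<tau> by (intro exI[of _ x0]) (simp add: lam_def)
qed

end
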